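(* Let $d\ge2$ be an integer and $a>0$ a constant, and let $n$ be such that $n^{1/d}$ is an integer. Place $n$ sensors in $[0,\infty)^d$ as follows: take $d$ independent homogeneous Poisson processes on $[0,\infty)$, each with rate $n^{1/d}$, let $X^{(j)}_1<\dots<X^{(j)}_{n^{1/d}}$ be the first $n^{1/d}$ arrival times of the $j$-th process, and put one sensor at each point $(X^{(1)}_{i_1},\dots,X^{(d)}_{i_d})$, $1\le i_1,\dots,i_d\le n^{1/d}$. Consider reallocations of the sensors satisfying: (a) sensors move only along the coordinate axes; (b) the final configuration again consists of axis-parallel lines ("rows and columns"): along each coordinate direction there are $n^{(d-1)/d}$ lines each containing $n^{1/d}$ sensors; (c) in each such line, every two consecutive sensors are at distance at least $s$ and at most $v$, where $s=v=\frac{1}{n^{1/d}}$. Then the expected minimal $d$-dimensional $a$-total movement of such a reallocation is $\Theta\!\left(n^{1-\frac{a}{2d}}\right)$ if $a\ge1$, and $O\!\left(n^{1-\frac{a}{2d}}\right)$ if $a\in(0,1)$.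
   Context: If a sensor $S_i$ at $(y_1(i),\dots,y_d(i))$ is moved to $(y_1(i)+m_1(i),\dots,y_d(i)+m_d(i))$, the $d$-dimensional $a$-total movement is $\sum_{i=1}^n\sum_{j=1}^d|m_j(i)|^a$. Asymptotics are as $n\to\infty$ with $a,d$ fixed. *)

theory Defs
  imports "HOL-Probability.Probability" "HOL-Library.Landau_Symbols"
begin

(* C t w is the number of arrivals in [0, t].  Because sample paths are nondecreasing,
   the truncated subtraction on nat in the increments is a genuine difference. *)
locale poisson_process = prob_space M
  for M :: "'w measure" and rate :: real and C :: "real \<Rightarrow> 'w \<Rightarrow> nat" +
  assumes rate_pos: "0 < rate"
    and counts_measurable: "0 \<le> t \<Longrightarrow> C t \<in> measurable M (count_space UNIV)"
    and start_zero: "\<omega> \<in> space M \<Longrightarrow> C 0 \<omega> = 0"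
    and path_mono: "\<omega> \<in> space M \<Longrightarrow> 0 \<le> s \<Longrightarrow> s \<le> t \<Longrightarrow> C s \<omega> \<le> C t \<omega>"
    and path_right_continuous:
      "\<omega> \<in> space M \<Longrightarrow> 0 \<le> t \<Longrightarrow> continuous (at_right t) (\<lambda>s. real (C s \<omega>))"
    and increments_poisson:
      "0 \<le> s \<Longrightarrow> s < t \<Longrightarrow>
        distr M (count_space UNIV) (\<lambda>\<omega>. C t \<omega> - C s \<omega>) = measure_pmf (poisson_pmf (rate * (t - s)))"
    and increments_indep:
      "0 \<le> u 0 \<Longrightarrow> mono_on {..n} u \<Longrightarrow>
        indep_vars (\<lambda>_. count_space UNIV) (\<lambda>k \<omega>. C (u (Suc k)) \<omega> - C (u k) \<omega>) {..<n}"

(* Joint independence of whole processes: each is a random element of the product space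
   of paths indexed by [0, infinity). *)
definition independent_processes :: "'w measure \<Rightarrow> ('d \<Rightarrow> real \<Rightarrow> 'w \<Rightarrow> nat) \<Rightarrow> bool" where
  "independent_processes M C \<longleftrightarrow>
     prob_space.indep_vars M (\<lambda>_. PiM {0..} (\<lambda>_. count_space UNIV))
       (\<lambda>j \<omega>. \<lambda>t\<in>{0..}. C j t \<omega>) UNIV"

(* On the null event that fewer than k arrivals ever occur this is the infimum of the
   empty set, hence an unspecified constant. *)
definition arrival_time :: "(real \<Rightarrow> 'w \<Rightarrow> nat) \<Rightarrow> nat \<Rightarrow> 'w \<Rightarrow> real" where
  "arrival_time C k \<omega> = Inf {t. 0 \<le> t \<and> k \<le> C t \<omega>}"

(* Throughout, N plays the role of n^(1/d), with d = CARD('d), so there are n = N^d sensors;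
   a sensor is named by its multi-index (i_1, ..., i_d). *)
definition sensors :: "nat \<Rightarrow> ('d::finite \<Rightarrow> nat) set" where
  "sensors N = {i. \<forall>j. i j \<in> {1..N}}"

definition initial_position ::
  "('d::finite \<Rightarrow> real \<Rightarrow> 'w \<Rightarrow> nat) \<Rightarrow> 'w \<Rightarrow> ('d \<Rightarrow> nat) \<Rightarrow> real^'d" where
  "initial_position C \<omega> i = (\<chi> j. arrival_time (C j) (i j) \<omega>)"

definition axis_line :: "'d::finite \<Rightarrow> real^'d \<Rightarrow> (real^'d) set" where
  "axis_line j x = {x + t *\<^sub>R axis j 1 | t. True}"

definition occupied_lines ::
  "nat \<Rightarrow> (('d::finite \<Rightarrow> nat) \<Rightarrow> real^'d) \<Rightarrow> 'd \<Rightarrow> (real^'d) set set" where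
  "occupied_lines N p j = (\<lambda>i. axis_line j (p i)) ` sensors N"

definition sensors_on ::
  "nat \<Rightarrow> (('d::finite \<Rightarrow> nat) \<Rightarrow> real^'d) \<Rightarrow> (real^'d) set \<Rightarrow> ('d \<Rightarrow> nat) set" where
  "sensors_on N p L = {i \<in> sensors N. p i \<in> L}"

(* Two distinct sensors at the same place count as consecutive, at distance 0; so s > 0
   rules out coinciding sensors. *)
definition consecutive ::
  "(('d::finite \<Rightarrow> nat) \<Rightarrow> real^'d) \<Rightarrow> 'd \<Rightarrow> ('d \<Rightarrow> nat) set \<Rightarrow> ('d \<Rightarrow> nat) \<Rightarrow> ('d \<Rightarrow> nat) \<Rightarrow> bool" where
  "consecutive p j S i i' \<longleftrightarrow>
     i \<in> S \<and> i' \<in> S \<and> i \<noteq> i' \<and> p i $ j \<le> p i' $ j \<and>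
     \<not> (\<exists>k\<in>S. p i $ j < p k $ j \<and> p k $ j < p i' $ j)"

definition rows_and_columns ::
  "nat \<Rightarrow> real \<Rightarrow> real \<Rightarrow> (('d::finite \<Rightarrow> nat) \<Rightarrow> real^'d) \<Rightarrow> bool" where
  "rows_and_columns N s v p \<longleftrightarrow>
     (\<forall>j. card (occupied_lines N p j) = N ^ (CARD('d) - 1) \<and>
       (\<forall>L\<in>occupied_lines N p j.
          card (sensors_on N p L) = N \<and>
          (\<forall>i i'. consecutive p j (sensors_on N p L) i i' \<longrightarrow>
             s \<le> dist (p i) (p i') \<and> dist (p i) (p i') \<le> v)))"

(* A movement m displaces sensor i by m i $ j along the j-th coordinate axis, for each j.
   Sensors may exchange their places in the grid. *)
definition reallocation ::
  "nat \<Rightarrow> real \<Rightarrow> real \<Rightarrow> (('d::finite \<Rightarrow> nat) \<Rightarrow> real^'d) \<Rightarrow> (('d \<Rightarrow> nat) \<Rightarrow> real^'d) \<Rightarrow> bool" where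
  "reallocation N s v x m \<longleftrightarrow> rows_and_columns N s v (\<lambda>i. x i + m i)"

definition total_movement ::
  "real \<Rightarrow> nat \<Rightarrow> (('d::finite \<Rightarrow> nat) \<Rightarrow> real^'d) \<Rightarrow> real" where
  "total_movement a N m = (\<Sum>i\<in>sensors N. \<Sum>j\<in>UNIV. \<bar>m i $ j\<bar> powr a)"

definition minimal_movement ::
  "real \<Rightarrow> nat \<Rightarrow> real \<Rightarrow> real \<Rightarrow> (('d::finite \<Rightarrow> nat) \<Rightarrow> real^'d) \<Rightarrow> real" where
  "minimal_movement a N s v x = Inf {total_movement a N m | m. reallocation N s v x m}"

end

theory Submission
  imports Defs
begin

text \<open>
  \<^bold>\<open>Upper bound.\<close> Move the sensor with index \<open>(i_1, \<dots>, i_d)\<close> to \<open>(i_1/N, \<dots>, i_d/N)\<close>. The arrival time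
  \<open>X_k\<close> is Erlang distributed and \<open>sqrt N * (X_k - k/N)\<close> has bounded exponential moments, so each of the
  \<open>d * N^d\<close> summands has expectation \<open>O(N powr (- a/2))\<close>.

  \<^bold>\<open>Lower bound.\<close> In an admissible final configuration every line has gaps at least \<open>1/N\<close>, so a slab
  \<open>t < y_j \<le> t + 1/2\<close> holds at most \<open>N^(d-1) * (N/2 + 1)\<close> sensors, wherever the rows are and however the
  sensors were permuted. Initially it holds \<open>N^(d-1)\<close> times the number of arrivals in a window of
  length \<open>1/2\<close>, which exceeds \<open>N/2\<close> by order \<open>sqrt N\<close> in mean positive part, by the second and fourth
  Poisson moments. A sensor moved by \<open>m\<close> crosses a threshold only for a set of thresholds of measure \<open>\<bar>m\<bar>\<close>, so
  integrating over \<open>t\<close> bounds the \<open>1\<close>-total movement from below. For \<open>a \<ge> 1\<close> use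
  \<open>u powr a \<ge> b powr (a-1) * (u - b)\<close> with \<open>b\<close> of order \<open>1 / sqrt N\<close>.
\<close>

section \<open>Poisson processes and their arrival times\<close>


lemma has_bochner_integral_poisson_iff:
  fixes f :: "nat \<Rightarrow> real"
  assumes "0 < r"
  shows "has_bochner_integral (measure_pmf (poisson_pmf r)) f S \<longleftrightarrow>
    summable (\<lambda>n. \<bar>f n\<bar> * (r ^ n / fact n * exp (- r))) \<and> (\<lambda>n. f n * (r ^ n / fact n * exp (- r))) sums S"
proof -
  have "has_bochner_integral (measure_pmf (poisson_pmf r)) f S \<longleftrightarrow>
     has_bochner_integral (count_space UNIV) (\<lambda>n. pmf (poisson_pmf r) n *\<^sub>R f n) S"
    unfolding measure_pmf_eq_density has_bochner_integral_iff
    by (subst integrable_density integral_density; simp)+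
  also have "\<dots> \<longleftrightarrow> summable (\<lambda>n. norm (pmf (poisson_pmf r) n *\<^sub>R f n)) \<and> (\<lambda>n. pmf (poisson_pmf r) n *\<^sub>R f n) sums S"
    using has_bochner_integral_count_space_nat[of "\<lambda>n. pmf (poisson_pmf r) n *\<^sub>R f n" S]
      sums_unique2[OF sums_integral_count_space_nat[of "\<lambda>n. pmf (poisson_pmf r) n *\<^sub>R f n"], of S]
    by (auto simp: has_bochner_integral_iff integrable_count_space_nat_iff)
  also have "\<dots> \<longleftrightarrow> summable (\<lambda>n. \<bar>f n\<bar> * (r ^ n / fact n * exp (- r))) \<and> (\<lambda>n. f n * (r ^ n / fact n * exp (- r))) sums S"
    using assms by (simp add: abs_mult mult_ac)
  finally show ?thesis .
qed

text \<open>The Stein-Chen identity \<open>E (n * f n) = r * E (f (n + 1))\<close>: the Poisson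
  weights satisfy \<open>(n + 1) * p (n + 1) = r * p n\<close>. Each application raises the degree
  of a computable moment by one.\<close>

lemma poisson_size_bias:
  fixes f :: "nat \<Rightarrow> real"
  assumes r: "0 < r"
    and f: "has_bochner_integral (measure_pmf (poisson_pmf r)) (\<lambda>n. f (Suc n)) S"
  shows "has_bochner_integral (measure_pmf (poisson_pmf r)) (\<lambda>n. real n * f n) (r * S)"
proof -
  let ?p = "\<lambda>n. r ^ n / fact n * exp (- r)"
  have s: "summable (\<lambda>n. \<bar>f (Suc n)\<bar> * ?p n)" "(\<lambda>n. f (Suc n) * ?p n) sums S"
    using f r by (simp_all add: has_bochner_integral_poisson_iff)
  have step: "real (Suc n) * ?p (Suc n) = r * ?p n" for n
    by (simp add: field_simps del: of_nat_Suc)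
  have "real (Suc n) * f (Suc n) * ?p (Suc n) = r * (f (Suc n) * ?p n)" for n
    using arg_cong[OF step[of n], of "\<lambda>x. f (Suc n) * x"] by (simp only: mult_ac)
  then have 1: "(\<lambda>n. real (Suc n) * f (Suc n) * ?p (Suc n)) sums (r * S)"
    using sums_mult[OF s(2), of r] by presburger
  have "\<bar>real (Suc n) * f (Suc n)\<bar> * ?p (Suc n) = r * (\<bar>f (Suc n)\<bar> * ?p n)" for n
    using arg_cong[OF step[of n], of "\<lambda>x. \<bar>f (Suc n)\<bar> * x"]
    by (simp only: abs_mult abs_of_nat mult_ac)
  then have 2: "summable (\<lambda>n. \<bar>real (Suc n) * f (Suc n)\<bar> * ?p (Suc n))"
    using summable_mult[OF s(1), of r] by presburger
  \<comment> \<open>The factor \<open>real n\<close> kills the term at \<open>n = 0\<close>, so the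
    index shift does not change the sum.\<close>
  have "(\<lambda>n. real n * f n * ?p n) sums (r * S)"
    using 1 unfolding sums_Suc_iff[of "\<lambda>n. real n * f n * ?p n" "r * S"] by simp
  moreover have "summable (\<lambda>n. \<bar>real n * f n\<bar> * ?p n)"
    using 2 unfolding summable_Suc_iff[of "\<lambda>n. \<bar>real n * f n\<bar> * ?p n"] .
  ultimately show ?thesis
    unfolding has_bochner_integral_poisson_iff[OF r] by blast
qed

text \<open>The raw moment of order \<open>k + 1\<close> is \<open>r\<close> times the mean of
  \<open>(n + 1) ^ k\<close>, which expands into lower raw moments; the central moments are linear
  combinations of these. What matters later is that the fourth is of the order of the square of the
  second.\<close>

lemma poisson_central_moments:
  assumes r: "0 < r"
  shows "has_bochner_integral (measure_pmf (poisson_pmf r)) (\<lambda>n. real n - r) 0"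
    and "has_bochner_integral (measure_pmf (poisson_pmf r)) (\<lambda>n. (real n - r)\<^sup>2) r"
    and "has_bochner_integral (measure_pmf (poisson_pmf r)) (\<lambda>n. (real n - r) ^ 4) (r + 3 * r\<^sup>2)"
proof -
  let ?I = "has_bochner_integral (measure_pmf (poisson_pmf r))"
  note intros = has_bochner_integral_add has_bochner_integral_diff has_bochner_integral_mult_right
  have m0: "?I (\<lambda>n. c) c" for c :: real
    by (simp add: has_bochner_integral_iff)
  have m1: "?I (\<lambda>n. real n) r"
    using poisson_size_bias[OF r m0[of 1]] by simp
  have m2: "?I (\<lambda>n. real n ^ 2) (r * (r + 1))"
    using poisson_size_bias[OF r, of "\<lambda>n. real n"] has_bochner_integral_add[OF m1 m0[of 1]]
    by (simp add: power2_eq_square add.commute)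
  have "real (Suc n) ^ 2 = real n ^ 2 + 2 * real n + 1" for n
    by (simp add: power2_eq_square algebra_simps)
  then have "?I (\<lambda>n. real (Suc n) ^ 2) (r * (r + 1) + 2 * r + 1)"
    by (simp only:) (intro intros m0 m1 m2)
  from poisson_size_bias[OF r, of "\<lambda>n. real n ^ 2", OF this]
  have m3: "?I (\<lambda>n. real n ^ 3) (r * (r * (r + 1) + 2 * r + 1))"
    by (simp only: power3_eq_cube power2_eq_square mult.assoc)
  have "real (Suc n) ^ 3 = real n ^ 3 + 3 * real n ^ 2 + 3 * real n + 1" for n
    by (simp add: power2_eq_square power3_eq_cube algebra_simps)
  then have "?I (\<lambda>n. real (Suc n) ^ 3)
      (r * (r * (r + 1) + 2 * r + 1) + 3 * (r * (r + 1)) + 3 * r + 1)"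
    by (simp only:) (intro intros m0 m1 m2 m3)
  from poisson_size_bias[OF r, of "\<lambda>n. real n ^ 3", OF this]
  have m4: "?I (\<lambda>n. real n ^ 4) (r * (r * (r * (r + 1) + 2 * r + 1) + 3 * (r * (r + 1)) + 3 * r + 1))"
    by (simp only: power3_eq_cube power4_eq_xxxx mult.assoc)
  show "?I (\<lambda>n. real n - r) 0"
    using has_bochner_integral_diff[OF m1 m0[of r]] by simp
  have "?I (\<lambda>n. real n ^ 2 - 2 * r * real n + r ^ 2) (r * (r + 1) - 2 * r * r + r ^ 2)"
    by (intro intros m0 m1 m2)
  then show "?I (\<lambda>n. (real n - r)\<^sup>2) r"
    by (simp add: power2_eq_square algebra_simps)
  have "?I (\<lambda>n. real n ^ 4 - 4 * r * real n ^ 3 + 6 * r ^ 2 * real n ^ 2 - 4 * r ^ 3 * real n + r ^ 4)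
     (r * (r * (r * (r + 1) + 2 * r + 1) + 3 * (r * (r + 1)) + 3 * r + 1)
       - 4 * r * (r * (r * (r + 1) + 2 * r + 1)) + 6 * r ^ 2 * (r * (r + 1)) - 4 * r ^ 3 * r + r ^ 4)"
    by (intro intros m0 m1 m2 m3 m4)
  then show "?I (\<lambda>n. (real n - r) ^ 4) (r + 3 * r\<^sup>2)"
    by (simp add: power2_eq_square power3_eq_cube power4_eq_xxxx algebra_simps)
qed

section \<open>Arrival times: measurability and Erlang law\<close>

context poisson_process
begin

abbreviation X :: "nat \<Rightarrow> 'w \<Rightarrow> real" where "X \<equiv> arrival_time C"

text \<open>If the infimum is at most \<open>t\<close>, monotonicity gives count at least
  \<open>k\<close> at every later time, and right continuity carries this to \<open>t\<close>
  itself. The level must be reached at some time \<open>u\<close>, as otherwise the infimum is that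
  of the empty set.\<close>

lemma arrival_time_le_iff:
  assumes w: "\<omega> \<in> space M" and ex: "0 \<le> u" "k \<le> C u \<omega>" and t: "0 \<le> t"
  shows "X k \<omega> \<le> t \<longleftrightarrow> k \<le> C t \<omega>"
proof
  assume "k \<le> C t \<omega>"
  then show "X k \<omega> \<le> t"
    unfolding arrival_time_def using t by (intro cInf_lower) (auto intro!: bdd_belowI[of _ 0])
next
  assume le: "X k \<omega> \<le> t"
  have reached: "real k \<le> real (C s \<omega>)" if s: "t < s" for s
  proof -
    have "Inf {t. 0 \<le> t \<and> k \<le> C t \<omega>} < s" using le s unfolding arrival_time_def by simp
    then obtain v where "0 \<le> v" "k \<le> C v \<omega>" "v < s"
      using cInf_lessD[of "{t. 0 \<le> t \<and> k \<le> C t \<omega>}" s] ex by auto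
    with path_mono[OF w, of v s] show ?thesis by simp
  qed
  have "((\<lambda>s. real (C s \<omega>)) \<longlongrightarrow> real (C t \<omega>)) (at_right t)"
    using path_right_continuous[OF w t] by (simp add: continuous_within)
  then have "real k \<le> real (C t \<omega>)"
    by (rule tendsto_lowerbound) (auto intro!: eventually_at_rightI[of t "t + 1"] reached[simplified])
  then show "k \<le> C t \<omega>" by simp
qed

lemma distr_count:
  assumes "0 < t"
  shows "distr M (count_space UNIV) (C t) = measure_pmf (poisson_pmf (rate * t))"
proof -
  have "distr M (count_space UNIV) (C t) = distr M (count_space UNIV) (\<lambda>\<omega>. C t \<omega> - C 0 \<omega>)"
    by (intro distr_cong) (auto simp: start_zero)
  then show ?thesis using increments_poisson[of 0 t] assms by simp
qed

lemma prob_count_less: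
  assumes t: "0 < t"
  shows "prob {\<omega> \<in> space M. C t \<omega> < k} = (\<Sum>n<k. (rate * t) ^ n * exp (- (rate * t)) / fact n)"
proof -
  have [measurable]: "C t \<in> measurable M (count_space UNIV)" using counts_measurable t by simp
  have "prob {\<omega> \<in> space M. C t \<omega> < k} = measure (distr M (count_space UNIV) (C t)) {..<k}"
    by (subst measure_distr) (auto intro!: arg_cong[where f=prob])
  also have "\<dots> = (\<Sum>n<k. pmf (poisson_pmf (rate * t)) n)"
    using distr_count[OF t] by (simp add: measure_measure_pmf_finite)
  also have "\<dots> = (\<Sum>n<k. (rate * t) ^ n * exp (- (rate * t)) / fact n)"
    using t rate_pos by simp
  finally show ?thesis .
qed

text \<open>The probability is at most that of fewer than \<open>k\<close> arrivals up to any time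
  \<open>n\<close>, a polynomial in \<open>n\<close> times \<open>exp (- rate * n)\<close>, which
  tends to 0.\<close>

lemma never_reached_null:
  "{\<omega> \<in> space M. \<forall>n::nat. C (real n) \<omega> < k} \<in> null_sets M"
proof -
  let ?B = "{\<omega> \<in> space M. \<forall>n::nat. C (real n) \<omega> < k}"
  have [measurable]: "C (real n) \<in> measurable M (count_space UNIV)" for n
    using counts_measurable by simp
  have B: "?B \<in> sets M" by measurable
  have le: "prob ?B \<le> (\<Sum>i<k. (rate * real n) ^ i * exp (- (rate * real n)) / fact i)" if "0 < n" for n
  proof -
    have "prob ?B \<le> prob {\<omega> \<in> space M. C (real n) \<omega> < k}"
      by (intro finite_measure_mono) auto
    then show ?thesis using prob_count_less[of "real n" k] that by simp
  qed
  have lim0: "((\<lambda>x. x ^ i * exp (- x) / fact i) \<longlongrightarrow> (0::real)) at_top" for i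
    using tendsto_divide[OF tendsto_power_div_exp_0[of i] tendsto_const[of "fact i :: real"]]
    by (simp add: exp_minus divide_inverse)
  have "filterlim (\<lambda>n. rate * real n) at_top sequentially"
    using rate_pos filterlim_real_sequentially by (rule filterlim_tendsto_pos_mult_at_top[OF tendsto_const])
  then have "(\<lambda>n. \<Sum>i<k. (rate * real n) ^ i * exp (- (rate * real n)) / fact i) \<longlonglongrightarrow> (\<Sum>i<k. 0)"
    by (intro tendsto_sum filterlim_compose[OF lim0])
  then have "(\<lambda>n. \<Sum>i<k. (rate * real n) ^ i * exp (- (rate * real n)) / fact i) \<longlonglongrightarrow> 0" by simp
  then have "prob ?B \<le> 0"
    by (rule tendsto_lowerbound)
      (use le in \<open>auto intro!: eventually_sequentiallyI[of 1]\<close>)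
  then have "prob ?B = 0" by (simp add: measure_le_0_iff)
  with B show ?thesis by (simp add: null_sets_def emeasure_eq_measure)
qed

text \<open>The exceptional set is the same for all \<open>t\<close>, so the quantifier over
  uncountably many times can stand inside the \<open>AE\<close>.\<close>

lemma arrival_time_le_AE:
  "AE \<omega> in M. \<forall>t\<ge>0. X k \<omega> \<le> t \<longleftrightarrow> k \<le> C t \<omega>"
  using AE_not_in[OF never_reached_null[of k]]
proof (rule AE_mp, intro AE_I2 impI)
  fix \<omega> assume w: "\<omega> \<in> space M" and "\<omega> \<notin> {\<omega> \<in> space M. \<forall>n::nat. C (real n) \<omega> < k}"
  then obtain n :: nat where "k \<le> C (real n) \<omega>" by (auto simp: not_less)
  then show "\<forall>t\<ge>0. X k \<omega> \<le> t \<longleftrightarrow> k \<le> C t \<omega>" using arrival_time_le_iff[OF w, of "real n"] by auto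
qed

text \<open>Measurability is needed on all of \<open>space M\<close>. On the null set
  \<open>?B\<close> where level \<open>k\<close> is never reached the value is the constant
  \<open>Inf {}\<close>; off \<open>?B\<close> the sublevel sets are events about a single
  count.\<close>

lemma arrival_time_measurable [measurable]: "X k \<in> borel_measurable M"
proof -
  let ?B = "{\<omega> \<in> space M. \<forall>n::nat. C (real n) \<omega> < k}"
  have B: "?B \<in> sets M" using never_reached_null[of k] by auto
  have C_meas: "C t \<in> measurable M (count_space UNIV)" if "0 \<le> t" for t
    using counts_measurable that by simp
  have on_B: "X k \<omega> = Inf {}" if w: "\<omega> \<in> ?B" for \<omega>
  proof -
    have "\<not> k \<le> C t \<omega>" if "0 \<le> t" for t
    proof -
      obtain n :: nat where "t \<le> real n" using real_arch_simple by blast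
      then have "C t \<omega> \<le> C (real n) \<omega>" using w path_mono that by auto
      with w show ?thesis by (auto simp: not_le intro: le_less_trans)
    qed
    then show ?thesis unfolding arrival_time_def by (metis (mono_tags, lifting) Collect_empty_eq)
  qed
  have off_B: "(X k \<omega> \<le> t) = (0 \<le> t \<and> k \<le> C t \<omega>)" if w: "\<omega> \<in> space M" "\<omega> \<notin> ?B" for \<omega> t
  proof -
    obtain n :: nat where n: "k \<le> C (real n) \<omega>" using w by (auto simp: not_less)
    have "0 \<le> X k \<omega>" unfolding arrival_time_def using n
      by (intro cInf_greatest) (auto intro: exI[of _ "real n"])
    then show ?thesis using arrival_time_le_iff[OF w(1) _ n, of t] by auto
  qed
  have "{\<omega> \<in> space M. X k \<omega> \<le> t} \<in> sets M" for t
  proof -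
    have "{\<omega> \<in> space M. X k \<omega> \<le> t} =
      {\<omega> \<in> ?B. Inf {} \<le> t} \<union> ({\<omega> \<in> space M. 0 \<le> t \<and> k \<le> C t \<omega>} - ?B)"
      (is "?L = ?R1 \<union> ?R2")
    proof (rule set_eqI)
      fix \<omega>
      show "\<omega> \<in> ?L \<longleftrightarrow> \<omega> \<in> ?R1 \<union> ?R2"
      proof (cases "\<omega> \<in> ?B")
        case True
        then show ?thesis using on_B[OF True] by simp
      next
        case False
        then have "\<omega> \<notin> ?R1" by (rule contrapos_nn) (erule CollectE, erule conjunct1)
        moreover have "\<omega> \<in> ?R2 \<longleftrightarrow> \<omega> \<in> {\<omega> \<in> space M. 0 \<le> t \<and> k \<le> C t \<omega>}"
          unfolding Diff_iff by (simp only: False not_False_eq_True simp_thms)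
        ultimately show ?thesis unfolding Un_iff using off_B[OF _ False, of t] by blast
      qed
    qed
    moreover have "{\<omega> \<in> ?B. Inf {} \<le> t} \<in> sets M" by (cases "Inf {} \<le> t") (use B in auto)
    moreover have "{\<omega> \<in> space M. 0 \<le> t \<and> k \<le> C t \<omega>} \<in> sets M"
    proof (cases "0 \<le> t")
      case True
      then have [measurable]: "C t \<in> measurable M (count_space UNIV)" by (rule C_meas)
      show ?thesis by measurable
    qed simp
    ultimately show ?thesis using B by (simp only: sets.Un sets.Diff)
  qed
  then show ?thesis by (simp add: borel_measurable_iff_le)
qed

text \<open>The event \<open>X k <= t\<close> is almost surely the complement of
  \<open>C t < k\<close>, and one minus this Poisson tail is the Erlang distribution function with
  shape index \<open>k - 1\<close>.\<close>

lemma arrival_time_distributed: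
  assumes k: "1 \<le> k"
  shows "distributed M lborel (X k) (erlang_density (k - 1) rate)"
proof -
  have "prob {\<omega> \<in> space M. X k \<omega> \<le> t} = erlang_CDF (k - 1) rate t" if t: "0 \<le> t" for t
  proof -
    have [measurable]: "C t \<in> measurable M (count_space UNIV)" using counts_measurable t by simp
    have "prob {\<omega> \<in> space M. X k \<omega> \<le> t} = prob {\<omega> \<in> space M. \<not> C t \<omega> < k}"
      using arrival_time_le_AE[of k] t by (intro measure_eq_AE) (auto simp: not_less)
    also have "\<dots> = 1 - prob {\<omega> \<in> space M. C t \<omega> < k}"
      by (intro prob_neg) measurable
    also have "prob {\<omega> \<in> space M. C t \<omega> < k} = (\<Sum>n<k. (rate * t) ^ n * exp (- (rate * t)) / fact n)"
    \<comment> \<open>At time 0 the Poisson formula has to be checked by hand: the count is 0, hence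
      below \<open>k\<close>, and the only surviving term of the sum is
      \<open>0 ^ 0 = 1\<close>.\<close>
    proof (cases "t = 0")
      case True
      have "{\<omega> \<in> space M. C 0 \<omega> < k} = space M" using k start_zero by auto
      moreover have "(\<Sum>n<k. 0 ^ n / fact n) = (1::real)"
        using k by (subst sum.remove[of _ 0]) (auto intro!: sum.neutral)
      ultimately show ?thesis using True by (simp add: prob_space)
    qed (use t prob_count_less in auto)
    also have "1 - \<dots> = erlang_CDF (k - 1) rate t"
      using t k by (simp add: erlang_CDF_def lessThan_Suc_atMost[symmetric])
    finally show ?thesis .
  qed
  then show ?thesis using rate_pos by (simp add: erlang_distributed_iff)
qed

end


section \<open>Elementary inequalities for exponentials and powers\<close>

lemma powr_le_exp:
  fixes y a :: real
  assumes "0 \<le> y" "0 < a"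
  shows "y powr a \<le> a powr a * exp y"
proof -
  have "y / a \<le> exp (y / a)" using exp_ge_add_one_self[of "y / a"] by linarith
  then have "y \<le> a * exp (y / a)" using assms by (simp add: field_simps)
  then have "y powr a \<le> (a * exp (y / a)) powr a" using assms by (intro powr_mono2) auto
  also have "\<dots> = a powr a * exp y" using assms by (simp add: powr_mult exp_powr_real)
  finally show ?thesis .
qed

lemma exp_abs_le: "exp \<bar>u\<bar> \<le> exp u + exp (- u :: real)"
  by (cases "0 \<le> u") auto

text \<open>The left side is \<open>exp (- ln (1 - v) - v)\<close>. Centring cancels the linear term
  of the logarithm, so only a quadratic error remains.\<close>

lemma inverse_one_minus_times_exp_le:
  assumes "\<bar>v\<bar> \<le> (1/2 :: real)"
  shows "1 / (1 - v) * exp (- v) \<le> exp (2 * v\<^sup>2)"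
proof -
  have "\<bar>ln (1 + - v) - (- v)\<bar> \<le> 2 * (- v)\<^sup>2"
    using assms by (intro abs_ln_one_plus_x_minus_x_bound) simp
  then have "- v - 2 * v\<^sup>2 \<le> ln (1 - v)" by (simp add: abs_le_iff)
  then have "exp (- v - 2 * v\<^sup>2) \<le> exp (ln (1 - v))" by simp
  also have "\<dots> = 1 - v" using assms by (intro exp_ln) linarith
  finally have "exp (- v - 2 * v\<^sup>2) \<le> 1 - v" .
  then show ?thesis using assms
    by (simp add: divide_simps exp_diff exp_minus mult_ac split: if_splits)
qed

text \<open>A polynomial minorant of the absolute value, which turns second and fourth moments into
  a lower bound for a first absolute moment. With \<open>u = \<bar>z\<bar> / s\<close> it reads
  \<open>0 <= u * (1 - u + u ^ 3)\<close>.\<close>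

lemma two_fourth_power_le:
  assumes "0 < (s::real)"
  shows "z\<^sup>2 / s - z ^ 4 / s ^ 3 \<le> \<bar>z\<bar>"
proof -
  define u where "u = \<bar>z\<bar> / s"
  have u: "0 \<le> u" using assms by (simp add: u_def)
  have "0 \<le> 1 - u + u ^ 3"
  proof (cases "u \<le> 1")
    case False
    then have "u ^ 1 \<le> u ^ 3" by (intro power_increasing) auto
    then show ?thesis by simp
  qed (use u in auto)
  then have "0 \<le> u * (1 - u + u ^ 3)" using u by simp
  then have "s * (u ^ 2 - u ^ 4) \<le> s * u"
    using assms by (intro mult_left_mono) (simp_all add: algebra_simps power2_eq_square power3_eq_cube power4_eq_xxxx)
  moreover have "s * u = \<bar>z\<bar>" using assms by (simp add: u_def)
  moreover have "s * (u ^ 2 - u ^ 4) = z\<^sup>2 / s - z ^ 4 / s ^ 3"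
  proof -
    have "z\<^sup>2 = (s * u)\<^sup>2" "z ^ 4 = (s * u) ^ 4" using assms by (simp_all add: u_def)
    then show ?thesis using assms
      by (simp add: field_simps power2_eq_square power3_eq_cube power4_eq_xxxx)
  qed
  ultimately show ?thesis by simp
qed

section \<open>Deviations of arrival times and the mean excess in a window\<close>

context poisson_process
begin

text \<open>Exponential tilting: \<open>exp (s * x)\<close> times the Erlang density of rate
  \<open>rate\<close> is a constant times the Erlang density of rate \<open>rate - s\<close>, which
  has mass 1.\<close>

lemma arrival_time_exp_moment:
  assumes k: "1 \<le> k" and s: "s < rate"
  shows "(\<integral>\<^sup>+\<omega>. ennreal (exp (s * X k \<omega>)) \<partial>M) = ennreal ((rate / (rate - s)) ^ k)"
proof -
  have "(\<integral>\<^sup>+\<omega>. ennreal (exp (s * X k \<omega>)) \<partial>M) =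
      (\<integral>\<^sup>+x. ennreal (erlang_density (k - 1) rate x) * ennreal (exp (s * x)) \<partial>lborel)"
    by (subst distributed_nn_integral[OF arrival_time_distributed[OF k]]) auto
  also have "\<dots> = (\<integral>\<^sup>+x. ennreal ((rate / (rate - s)) ^ k) * ennreal (erlang_density (k - 1) (rate - s) x) \<partial>lborel)"
  proof (intro nn_integral_cong)
    fix x :: real
    have "exp (- (rate * x)) * exp (s * x) = exp (- ((rate - s) * x))"
      by (simp add: mult_exp_exp algebra_simps)
    then have "erlang_density (k - 1) rate x * exp (s * x) =
        (rate / (rate - s)) ^ k * erlang_density (k - 1) (rate - s) x"
      using k s by (simp add: erlang_density_def power_divide field_simps)
    then show "ennreal (erlang_density (k - 1) rate x) * ennreal (exp (s * x)) =
        ennreal ((rate / (rate - s)) ^ k) * ennreal (erlang_density (k - 1) (rate - s) x)"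
      using s rate_pos by (simp add: ennreal_mult[symmetric])
  qed
  also have "\<dots> = ennreal ((rate / (rate - s)) ^ k) * (\<integral>\<^sup>+x. ennreal (erlang_density (k - 1) (rate - s) x) \<partial>lborel)"
    by (intro nn_integral_cmult) auto
  also have "(\<integral>\<^sup>+x. ennreal (erlang_density (k - 1) (rate - s) x) \<partial>lborel) = 1"
    using nn_integral_erlang_ith_moment[of "rate - s" "k - 1" 0] s by simp
  finally show ?thesis by simp
qed

text \<open>With \<open>v = s / rate\<close> the centred moment is the \<open>k\<close>-th power of
  \<open>1 / (1 - v) * exp (- v)\<close>, hence at most \<open>exp (2 * v^2 * k)\<close>. The choice
  of \<open>s\<close> gives \<open>v^2 = 1 / (4 * rate)\<close>, and \<open>k <= rate\<close> makes
  the exponent at most \<open>1/2\<close>.\<close>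

lemma arrival_time_centered_exp_moment:
  assumes k: "1 \<le> k" "real k \<le> rate" and rate: "1 \<le> rate" and s: "\<bar>s\<bar> = sqrt rate / 2"
  shows "(\<integral>\<^sup>+\<omega>. ennreal (exp (s * (X k \<omega> - real k / rate))) \<partial>M) \<le> ennreal (exp (1/2))"
proof -
  define v where "v = s / rate"
  have "sqrt rate \<le> rate" using rate real_sqrt_le_mono[of rate "rate\<^sup>2"] by (simp add: power2_eq_square)
  then have v: "\<bar>v\<bar> \<le> 1/2" using s rate by (simp add: v_def field_simps)
  then have s_less: "s < rate" using rate unfolding v_def by (simp add: abs_le_iff field_simps)
  have v2: "v\<^sup>2 = 1 / (4 * rate)"
  proof -
    have "v\<^sup>2 = \<bar>s\<bar>\<^sup>2 / rate\<^sup>2" by (simp add: v_def power_divide)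
    then show ?thesis using rate by (simp add: s power_divide power2_eq_square[of rate])
  qed
  have "(\<integral>\<^sup>+\<omega>. ennreal (exp (s * (X k \<omega> - real k / rate))) \<partial>M)
      = (\<integral>\<^sup>+\<omega>. ennreal (exp (- v) ^ k) * ennreal (exp (s * X k \<omega>)) \<partial>M)"
    by (intro nn_integral_cong)
      (simp add: ennreal_mult[symmetric] exp_of_nat_mult[symmetric] mult_exp_exp v_def algebra_simps)
  also have "\<dots> = ennreal (exp (- v) ^ k) * ennreal ((rate / (rate - s)) ^ k)"
    by (subst nn_integral_cmult) (auto simp: arrival_time_exp_moment[OF k(1) s_less])
  also have "\<dots> = ennreal ((1 / (1 - v) * exp (- v)) ^ k)"
  proof -
    have "rate / (rate - s) = 1 / (1 - v)" using rate by (simp add: v_def field_simps)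
    then show ?thesis using v by (simp add: ennreal_mult[symmetric] power_mult_distrib[symmetric])
  qed
  also have "\<dots> \<le> ennreal (exp (2 * v\<^sup>2) ^ k)"
    using v by (intro ennreal_leI power_mono inverse_one_minus_times_exp_le) auto
  also have "exp (2 * v\<^sup>2) ^ k = exp (real k / rate / 2)"
    by (simp add: exp_of_nat_mult[symmetric] v2)
  also have "\<dots> \<le> exp (1/2)" using k rate by simp
  finally show ?thesis by (simp add: ennreal_leI)
qed

text \<open>Rescaling by \<open>s = sqrt rate / 2\<close> makes both exponential moments of the
  deviation bounded, and \<open>powr_le_exp\<close> trades the power \<open>a\<close> for them;
  undoing the scaling yields \<open>rate powr (- a / 2)\<close>.\<close>

lemma arrival_time_deviation:
  assumes k: "1 \<le> k" "real k \<le> rate" and rate: "1 \<le> rate" and a: "0 < a"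
  shows "(\<integral>\<^sup>+\<omega>. ennreal (\<bar>X k \<omega> - real k / rate\<bar> powr a) \<partial>M)
    \<le> ennreal (2 * exp (1/2) * (2 * a) powr a * rate powr (- a / 2))"
proof -
  define Y where "Y \<omega> = X k \<omega> - real k / rate" for \<omega>
  have [measurable]: "Y \<in> borel_measurable M" unfolding Y_def by measurable
  define s where "s = sqrt rate / 2"
  define K where "K = (2 * a) powr a * rate powr (- a / 2)"
  have s: "0 < s" using rate by (simp add: s_def)
  have K: "K = (1 / s) powr a * a powr a"
    using rate a by (simp add: K_def s_def powr_divide powr_mult powr_minus_divide powr_half_sqrt[symmetric] powr_powr)
  have "\<bar>Y \<omega>\<bar> powr a \<le> K * (exp (s * Y \<omega>) + exp (- s * Y \<omega>))" for \<omega>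
  proof -
    have "\<bar>Y \<omega>\<bar> powr a = (1 / s) powr a * \<bar>s * Y \<omega>\<bar> powr a"
      using s by (subst powr_mult[symmetric]) (auto simp: abs_mult)
    also have "\<dots> \<le> (1 / s) powr a * (a powr a * (exp (s * Y \<omega>) + exp (- (s * Y \<omega>))))"
      using powr_le_exp[of "\<bar>s * Y \<omega>\<bar>" a] a exp_abs_le[of "s * Y \<omega>"]
      by (intro mult_left_mono order.trans[OF powr_le_exp]) auto
    finally show ?thesis by (simp add: K mult.assoc)
  qed
  then have "(\<integral>\<^sup>+\<omega>. ennreal (\<bar>Y \<omega>\<bar> powr a) \<partial>M)
      \<le> (\<integral>\<^sup>+\<omega>. ennreal (K * (exp (s * Y \<omega>) + exp (- s * Y \<omega>))) \<partial>M)"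
    by (intro nn_integral_mono ennreal_leI)
  also have "\<dots> = ennreal K * ((\<integral>\<^sup>+\<omega>. ennreal (exp (s * Y \<omega>)) \<partial>M) + (\<integral>\<^sup>+\<omega>. ennreal (exp (- s * Y \<omega>)) \<partial>M))"
    by (subst nn_integral_add[symmetric], measurable, subst nn_integral_cmult[symmetric], measurable)
      (simp add: ennreal_mult' K_def)
  also have "\<dots> \<le> ennreal K * (ennreal (exp (1/2)) + ennreal (exp (1/2)))"
    unfolding Y_def using s
    by (intro mult_left_mono add_mono arrival_time_centered_exp_moment[OF k rate]) (auto simp: s_def)
  also have "\<dots> = ennreal (2 * exp (1/2) * K)"
    by (simp add: ennreal_plus[symmetric] ennreal_mult'[symmetric] K_def mult_ac del: ennreal_plus)
  finally show ?thesis by (simp add: Y_def K_def mult_ac)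
qed

lemma increment_has_bochner_integral:
  fixes f :: "nat \<Rightarrow> real"
  assumes "0 \<le> s" "s < t"
    and f: "has_bochner_integral (measure_pmf (poisson_pmf (rate * (t - s)))) f S"
  shows "has_bochner_integral M (\<lambda>\<omega>. f (C t \<omega> - C s \<omega>)) S"
proof -
  have [measurable]: "C t \<in> measurable M (count_space UNIV)" "C s \<in> measurable M (count_space UNIV)"
    using counts_measurable assms by auto
  have D: "(\<lambda>\<omega>. C t \<omega> - C s \<omega>) \<in> measurable M (count_space UNIV)"
    by measurable
  have "has_bochner_integral (distr M (count_space UNIV) (\<lambda>\<omega>. C t \<omega> - C s \<omega>)) f S"
    using f increments_poisson[OF assms(1,2)] by simp
  moreover have "f \<in> borel_measurable (count_space UNIV)" by simp
  ultimately show ?thesis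
    unfolding has_bochner_integral_iff using integrable_distr_eq[OF D, of f] integral_distr[OF D, of f] by metis
qed

text \<open>The mean of the positive part of the centred window count is bounded below by moments.
  Only the first \<open>N\<close> arrivals carry sensors, so later arrivals have to be discounted;
  this costs at most \<open>3/4\<close> in the mean and, with the \<open>1\<close> in the statement,
  gives \<open>7/4\<close>.\<close>

lemma expected_excess:
  assumes N: "rate = real N" "2 \<le> N" and t: "0 \<le> t" "t \<le> 1/4"
  shows "ennreal (sqrt (real N) / 16 - 7/4)
    \<le> (\<integral>\<^sup>+\<omega>. ennreal (real (card {k \<in> {1..N}. t < X k \<omega> \<and> X k \<omega> \<le> t + 1/2}) - real N / 2 - 1) \<partial>M)"
proof -
  define r where "r = real N / 2"
  \<comment> \<open>By \<open>r + 3 * r^2 <= 4 * r^2\<close>, this scale gives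
    \<open>r / s - (r + 3 * r^2) / s ^ 3 >= 3/16 * sqrt r\<close>.\<close>
  define s where "s = 4 * sqrt r"
  define z where "z \<omega> = real (C (t + 1/2) \<omega> - C t \<omega>) - r" for \<omega>
  define w where "w \<omega> = real (C (t + 1/2) \<omega> - C 0 \<omega>) - real N * (t + 1/2)" for \<omega>
  \<comment> \<open>A polynomial minorant of the excess: the first part stays below the positive
    part of \<open>z\<close>, since that is half of \<open>z + \<bar>z\<bar>\<close>, and
    \<open>w^2 / N\<close> pays for the arrivals after the \<open>N\<close>-th.\<close>
  define g where "g \<omega> = (z \<omega> + ((z \<omega>)\<^sup>2 / s - z \<omega> ^ 4 / s ^ 3)) / 2 - (w \<omega>)\<^sup>2 / real N - 1" for \<omega>
  have r: "1 \<le> r" and s: "0 < s" using N by (auto simp: r_def s_def)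
  have z: "has_bochner_integral M z 0" "has_bochner_integral M (\<lambda>\<omega>. (z \<omega>)\<^sup>2) r"
      "has_bochner_integral M (\<lambda>\<omega>. z \<omega> ^ 4) (r + 3 * r\<^sup>2)"
    unfolding z_def using t N r
    by (auto intro!: increment_has_bochner_integral poisson_central_moments simp: r_def)
  have w: "has_bochner_integral M (\<lambda>\<omega>. (w \<omega>)\<^sup>2) (real N * (t + 1/2))"
    unfolding w_def using t N
    by (intro increment_has_bochner_integral[where f = "\<lambda>n. (real n - real N * (t + 1/2))\<^sup>2"])
      (auto intro!: poisson_central_moments)
  have g: "has_bochner_integral M g ((0 + (r / s - (r + 3 * r\<^sup>2) / s ^ 3)) / 2 - real N * (t + 1/2) / real N - 1)"
    unfolding g_def using z w
    by (intro has_bochner_integral_add has_bochner_integral_diff has_bochner_integral_divide_zero)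
      (auto simp: has_bochner_integral_iff prob_space)
  have "sqrt (real N) / 16 - 7/4 \<le> (0 + (r / s - (r + 3 * r\<^sup>2) / s ^ 3)) / 2 - real N * (t + 1/2) / real N - 1"
  proof -
    have r_sq: "r = sqrt r * sqrt r" using r by simp
    have "r / s = sqrt r / 4"
      unfolding s_def using r by (subst r_sq) (simp del: real_sqrt_mult_self)
    moreover have "(r + 3 * r\<^sup>2) / s ^ 3 \<le> sqrt r / 16"
    proof -
      have "r + 3 * r\<^sup>2 \<le> 4 * r\<^sup>2" using r by (simp add: power2_eq_square)
      also have "\<dots> = sqrt r / 16 * s ^ 3"
        unfolding s_def using r by (simp add: power2_eq_square power3_eq_cube mult_ac) 
      finally show ?thesis using s by (simp add: divide_simps)
    qed
    \<comment> \<open>A rational substitute for \<open>1 / sqrt 2\<close>: half of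
      \<open>3/16 * 2/3\<close> is the factor \<open>1/16\<close> of the claim.\<close>
    moreover have "2/3 * sqrt (real N) \<le> sqrt r"
    proof -
      have "2/3 * sqrt (real N) = sqrt ((2/3)\<^sup>2 * real N)" by (simp add: real_sqrt_mult)
      also have "\<dots> \<le> sqrt r" by (simp add: r_def power2_eq_square)
      finally show ?thesis .
    qed
    moreover have "real N * (t + 1/2) / real N \<le> 3/4" using N t by simp
    ultimately show ?thesis by argo
  qed
  then have "ennreal (sqrt (real N) / 16 - 7/4) \<le> ennreal (\<integral>\<omega>. g \<omega> \<partial>M)"
    using g by (intro ennreal_leI) (simp add: has_bochner_integral_iff)
  also have "\<dots> \<le> ennreal (\<integral>\<omega>. max 0 (g \<omega>) \<partial>M)"
    using g by (intro ennreal_leI integral_mono) (auto simp: has_bochner_integral_iff)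
  also have "\<dots> = (\<integral>\<^sup>+\<omega>. ennreal (max 0 (g \<omega>)) \<partial>M)"
    using g by (intro nn_integral_eq_integral[symmetric]) (auto simp: has_bochner_integral_iff)
  also have "\<dots> \<le> (\<integral>\<^sup>+\<omega>. ennreal (real (card {k \<in> {1..N}. t < X k \<omega> \<and> X k \<omega> \<le> t + 1/2}) - real N / 2 - 1) \<partial>M)"
  proof (intro nn_integral_mono_AE)
    have "AE \<omega> in M. \<forall>k. \<forall>t\<ge>0. X k \<omega> \<le> t \<longleftrightarrow> k \<le> C t \<omega>"
      by (subst AE_all_countable) (intro allI arrival_time_le_AE)
    then show "AE \<omega> in M. ennreal (max 0 (g \<omega>))
      \<le> ennreal (real (card {k \<in> {1..N}. t < X k \<omega> \<and> X k \<omega> \<le> t + 1/2}) - real N / 2 - 1)"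
    proof (rule AE_mp, intro AE_I2 impI)
      fix \<omega> assume \<omega>: "\<omega> \<in> space M" and iff: "\<forall>k. \<forall>t\<ge>0. X k \<omega> \<le> t \<longleftrightarrow> k \<le> C t \<omega>"
      define c where "c = C t \<omega>"
      define c' where "c' = C (t + 1/2) \<omega>"
      have cc': "c \<le> c'" using path_mono[OF \<omega>, of t "t + 1/2"] t by (simp add: c_def c'_def)
      have "{k \<in> {1..N}. t < X k \<omega> \<and> X k \<omega> \<le> t + 1/2} = {k \<in> {1..N}. c < k \<and> k \<le> c'}"
        using iff t unfolding c_def c'_def by (auto simp: not_le[symmetric])
      also have "\<dots> = {c<..min c' N}" by auto
      finally have card: "card {k \<in> {1..N}. t < X k \<omega> \<and> X k \<omega> \<le> t + 1/2} = min c' N - c" by simp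
      have z: "z \<omega> = real c' - real c - r" using cc' by (simp add: z_def c_def c'_def)
      have w: "w \<omega> = real c' - real N * (t + 1/2)" using start_zero[OF \<omega>] by (simp add: w_def c'_def)
      text \<open>\<open>x - h \<le> x\<^sup>2 / (4 h)\<close> with \<open>h = N / 4\<close> bounds the arrivals after the \<open>N\<close>-th one.\<close>
      have "real c' - real N \<le> (w \<omega>)\<^sup>2 / real N"
      proof -
        have "real c' - real N \<le> w \<omega> - real N / 4"
          using t N mult_left_mono[of "t + 1/2" "3/4" "real N"] by (simp add: w algebra_simps)
        also have "\<dots> \<le> (w \<omega>)\<^sup>2 / real N"
        proof -
          have "0 \<le> (w \<omega> - real N / 2)\<^sup>2" by simp
          then have "(w \<omega> - real N / 4) * real N \<le> (w \<omega>)\<^sup>2" by (simp add: power2_eq_square algebra_simps)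
          then show ?thesis using N by (simp add: pos_le_divide_eq)
        qed
        finally show ?thesis .
      qed
      moreover have "0 \<le> (w \<omega>)\<^sup>2 / real N" by simp
      moreover have "(z \<omega> + ((z \<omega>)\<^sup>2 / s - z \<omega> ^ 4 / s ^ 3)) / 2 \<le> max 0 (z \<omega>)"
        using two_fourth_power_le[OF s, of "z \<omega>"] by (simp add: max_def abs_if split: if_splits)
      ultimately have "g \<omega> \<le> max 0 (z \<omega>) - max 0 (real c' - real N) - 1"
        unfolding g_def by linarith
      then have "g \<omega> \<le> max 0 (min (real c') (real N) - real c - real N / 2 - 1)"
        unfolding z r_def max_def min_def by (smt (verit))
      \<comment> \<open>Subtraction on \<open>nat\<close> truncates at 0, so it can only enlarge the
        real difference; this covers windows that open after the \<open>N\<close>-th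
        arrival.\<close>
      also have "min (real c') (real N) - real c \<le> real (min c' N - c)"
        by (simp add: min_def, linarith)
      finally have "max 0 (g \<omega>) \<le> max 0 (real (min c' N - c) - real N / 2 - 1)"
        by simp
      then show "ennreal (max 0 (g \<omega>))
        \<le> ennreal (real (card {k \<in> {1..N}. t < X k \<omega> \<and> X k \<omega> \<le> t + 1/2}) - real N / 2 - 1)"
        unfolding card using ennreal_leI[OF \<open>max 0 (g \<omega>) \<le> _\<close>] by (simp only: ennreal_max_0 ennreal_max_0')
    qed
  qed
  finally show ?thesis .
qed

end

section \<open>Sensors, axis lines and final configurations\<close>


lemma finite_sensors [simp]: "finite (sensors N :: ('d::finite \<Rightarrow> nat) set)"
proof -
  have "sensors N = (PiE UNIV (\<lambda>_. {1..N}) :: ('d \<Rightarrow> nat) set)"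
    by (auto simp: sensors_def PiE_def Pi_def)
  moreover have "finite \<dots>" by (rule finite_PiE) simp_all
  ultimately show ?thesis by (rule ssubst)
qed

lemma card_sensors_slice:
  fixes j :: "'d::finite"
  assumes "k \<in> {1..N}"
  shows "card {i \<in> sensors N. i j = k} = N ^ (CARD('d) - 1)"
proof -
  have "{i \<in> sensors N. i j = k} = PiE UNIV (\<lambda>l. if l = j then {k} else {1..N})"
  proof (intro set_eqI iffI)
    fix i :: "'d \<Rightarrow> nat"
    assume "i \<in> PiE UNIV (\<lambda>l. if l = j then {k} else {1..N})"
    then have i: "i l \<in> (if l = j then {k} else {1..N})" for l by (auto simp: PiE_def Pi_def)
    then have "i l \<in> {1..N}" for l using assms i[of l] by (cases "l = j") auto
    with i[of j] show "i \<in> {i \<in> sensors N. i j = k}" by (simp add: sensors_def)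
  qed (auto simp: sensors_def PiE_def Pi_def)
  then have "card {i \<in> sensors N. i j = k} = (\<Prod>l\<in>UNIV. card (if l = j then {k} else {1..N}))"
    by (simp add: card_PiE)
  also have "\<dots> = card {k} * (\<Prod>l\<in>UNIV - {j}. card (if l = j then {k} else {1..N}))"
    by (subst prod.remove[of UNIV j]) auto
  also have "(\<Prod>l\<in>UNIV - {j}. card (if l = j then {k} else {1..N})) = (\<Prod>l\<in>UNIV - {j}. N)"
    by (intro prod.cong) auto
  finally show ?thesis by (simp add: card_Diff_singleton)
qed

text \<open>Group the sensors by their \<open>j\<close>-th index; all fibres have the same size.
  This reduces sums over the grid to sums over the arrivals of one process.\<close>

lemma sum_sensors_coordinate:
  fixes j :: "'d::finite" and f :: "nat \<Rightarrow> real"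
  shows "(\<Sum>i\<in>sensors N. f (i j)) = real N ^ (CARD('d) - 1) * (\<Sum>k=1..N. f k)"
proof -
  have "(\<Sum>i\<in>sensors N. f (i j)) = (\<Sum>k=1..N. \<Sum>i\<in>{i \<in> sensors N. i j = k}. f (i j))"
    by (rule sum.group[symmetric]) (simp, simp, auto simp: sensors_def)
  also have "\<dots> = (\<Sum>k=1..N. \<Sum>i\<in>{i \<in> sensors N. i j = k}. f k)"
    by (intro sum.cong refl) simp
  also have "\<dots> = (\<Sum>k=1..N. real N ^ (CARD('d) - 1) * f k)"
    by (intro sum.cong refl) (simp only: sum_constant card_sensors_slice of_nat_power)
  finally show ?thesis by (simp add: sum_distrib_left)
qed

lemma card_sensors_coordinate:
  fixes j :: "'d::finite"
  shows "card {i \<in> sensors N. P (i j)} = N ^ (CARD('d) - 1) * card {k \<in> {1..N}. P k}"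
proof -
  have "real (card {i \<in> sensors N. P (i j)}) = (\<Sum>i\<in>sensors N. if P (i j) then 1 else 0)"
    by (simp add: sum.If_cases Int_def)
  also have "\<dots> = real N ^ (CARD('d) - 1) * (\<Sum>k=1..N. if P k then 1 else 0)"
    by (rule sum_sensors_coordinate)
  also have "(\<Sum>k=1..N. if P k then 1 else 0) = real (card {k \<in> {1..N}. P k})"
    by (simp add: sum.If_cases Int_def)
  finally have "real (card {i \<in> sensors N. P (i j)}) = real (N ^ (CARD('d) - 1) * card {k \<in> {1..N}. P k})"
    by simp
  then show ?thesis by (simp only: of_nat_eq_iff)
qed

section \<open>Axis-parallel lines, separation and slab counts\<close>

lemma mem_axis_line_iff: "y \<in> axis_line j x \<longleftrightarrow> (\<forall>l. l \<noteq> j \<longrightarrow> y $ l = x $ l)"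
proof
  assume "\<forall>l. l \<noteq> j \<longrightarrow> y $ l = x $ l"
  then have "y = x + (y $ j - x $ j) *\<^sub>R axis j 1"
    by (simp add: vec_eq_iff axis_def)
  then show "y \<in> axis_line j x" unfolding axis_line_def by blast
qed (auto simp: axis_line_def axis_def)

lemma axis_line_eq_iff: "axis_line j x = axis_line j y \<longleftrightarrow> (\<forall>l. l \<noteq> j \<longrightarrow> x $ l = y $ l)"
proof
  assume "axis_line j x = axis_line j y"
  then have "x \<in> axis_line j y" using mem_axis_line_iff[of x j x] by simp
  then show "\<forall>l. l \<noteq> j \<longrightarrow> x $ l = y $ l" by (simp add: mem_axis_line_iff)
qed (auto simp: set_eq_iff mem_axis_line_iff)

lemma dist_eq_coordinate:
  fixes x y :: "real^'d::finite"
  assumes "\<And>l. l \<noteq> j \<Longrightarrow> x $ l = y $ l"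
  shows "dist x y = \<bar>x $ j - y $ j\<bar>"
proof -
  have "x - y = (x $ j - y $ j) *\<^sub>R axis j 1"
    using assms by (simp add: vec_eq_iff axis_def)
  then have "norm (x - y) = \<bar>x $ j - y $ j\<bar> * norm (axis j 1 :: real^'d)"
    by (metis norm_scaleR)
  then show ?thesis by (simp add: dist_norm)
qed

text \<open>Pigeonhole on half-open cells of length \<open>1 / N\<close>, numbered from
  \<open>t\<close> by the ceiling: two reals with equal ceilings differ by less than 1, so each cell
  holds at most one point.\<close>

lemma card_separated_le:
  fixes q :: "'i \<Rightarrow> real" and N :: nat
  assumes fin: "finite S"
    and sep: "\<And>i i'. i \<in> S \<Longrightarrow> i' \<in> S \<Longrightarrow> i \<noteq> i' \<Longrightarrow> 1 / real N \<le> \<bar>q i - q i'\<bar>"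
    and N: "1 \<le> N" and t: "t \<le> t'"
  shows "real (card {i \<in> S. t < q i \<and> q i \<le> t'}) \<le> real N * (t' - t) + 1"
proof -
  define f where "f i = \<lceil>real N * (q i - t)\<rceil>" for i
  let ?T = "{i \<in> S. t < q i \<and> q i \<le> t'}"
  have "inj_on f ?T"
  proof (rule inj_onI, rule ccontr)
    fix i i' assume i: "i \<in> ?T" "i' \<in> ?T" "f i = f i'" "i \<noteq> i'"
    then have "1 / real N \<le> \<bar>q i - q i'\<bar>" using sep by auto
    then have "1 \<le> real N * \<bar>q i - q i'\<bar>" using N by (simp add: field_simps)
    also have "\<dots> = \<bar>real N * (q i - t) - real N * (q i' - t)\<bar>"
      by (simp add: right_diff_distrib[symmetric] abs_mult)
    finally show False using i(3) unfolding f_def by linarith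
  qed
  moreover have "f ` ?T \<subseteq> {1..\<lceil>real N * (t' - t)\<rceil>}"
  proof (rule image_subsetI)
    fix i assume "i \<in> ?T"
    then have "0 < real N * (q i - t)" "real N * (q i - t) \<le> real N * (t' - t)" using N by auto
    then show "f i \<in> {1..\<lceil>real N * (t' - t)\<rceil>}" unfolding f_def by (auto intro: ceiling_mono) 
  qed
  ultimately have "card ?T \<le> card {1..\<lceil>real N * (t' - t)\<rceil>}"
    by (metis card_image card_mono finite_atLeastAtMost_int)
  then have "real (card ?T) \<le> real (nat \<lceil>real N * (t' - t)\<rceil>)" by simp
  also have "\<dots> = real_of_int \<lceil>real N * (t' - t)\<rceil>"
    using t by (simp add: order.trans[OF _ ceiling_mono[of 0]])
  also have "\<dots> \<le> real N * (t' - t) + 1" by linarith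
  finally show ?thesis .
qed

text \<open>Only consecutive sensors are constrained by definition. For an arbitrary pair, the lower
  sensor is consecutive to its nearest successor on the line, and the other sensor is no closer than
  that one.\<close>

lemma rows_and_columns_separated:
  fixes p :: "('d::finite \<Rightarrow> nat) \<Rightarrow> real^'d"
  assumes rc: "rows_and_columns N s v p" and L: "L \<in> occupied_lines N p j"
    and i: "i \<in> sensors_on N p L" "i' \<in> sensors_on N p L" "i \<noteq> i'"
  shows "s \<le> \<bar>p i $ j - p i' $ j\<bar>"
proof -
  let ?S = "sensors_on N p L"
  have fin: "finite ?S" by (simp add: sensors_on_def)
  have dist: "dist (p k) (p k') = \<bar>p k $ j - p k' $ j\<bar>" if "k \<in> ?S" "k' \<in> ?S" for k k'
    using that L by (intro dist_eq_coordinate) (auto simp: sensors_on_def occupied_lines_def mem_axis_line_iff)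
  have *: "s \<le> p k' $ j - p k $ j" if k: "k \<in> ?S" "k' \<in> ?S" "k \<noteq> k'" "p k $ j \<le> p k' $ j" for k k'
  proof -
    \<comment> \<open>The non-strict comparison admits ties, so a coinciding sensor counts as a
      successor.\<close>
    define R where "R = {l \<in> ?S. l \<noteq> k \<and> p k $ j \<le> p l $ j}"
    have "finite R" "k' \<in> R" using k fin by (auto simp: R_def)
    then obtain l where l: "l \<in> R" "\<And>l'. l' \<in> R \<Longrightarrow> p l $ j \<le> p l' $ j"
      using ex_is_arg_min_if_finite[of R "\<lambda>l. p l $ j"] by (auto simp: is_arg_min_linorder)
    have "consecutive p j ?S k l"
      using l k unfolding consecutive_def R_def by fastforce
    then have "s \<le> dist (p k) (p l)" using rc L by (auto simp: rows_and_columns_def)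
    also have "\<dots> = p l $ j - p k $ j" using dist[of k l] k(1) l(1) by (auto simp: R_def)
    also have "\<dots> \<le> p k' $ j - p k $ j" using l(2)[OF \<open>k' \<in> R\<close>] by simp
    finally show ?thesis .
  qed
  show ?thesis using *[of i i'] *[of i' i] i by (cases "p i $ j \<le> p i' $ j") auto
qed

text \<open>The occupied lines in direction \<open>j\<close> cover all sensors, their number is
  prescribed, and separation bounds the contribution of each. Neither the places of the lines nor
  the labels of the sensors enter.\<close>

lemma rows_and_columns_slab_card:
  fixes p :: "('d::finite \<Rightarrow> nat) \<Rightarrow> real^'d"
  assumes rc: "rows_and_columns N (1 / real N) v p" and N: "1 \<le> N" and t: "t \<le> t'"
  shows "real (card {i \<in> sensors N. t < p i $ j \<and> p i $ j \<le> t'})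
    \<le> real N ^ (CARD('d) - 1) * (real N * (t' - t) + 1)"
proof -
  let ?O = "occupied_lines N p j"
  let ?A = "\<lambda>L. {i \<in> sensors_on N p L. t < p i $ j \<and> p i $ j \<le> t'}"
  have fin: "finite ?O" "finite (sensors_on N p L)" for L
    by (simp_all add: occupied_lines_def sensors_on_def)
  have "{i \<in> sensors N. t < p i $ j \<and> p i $ j \<le> t'} = (\<Union>L\<in>?O. ?A L)"
    by (auto simp: occupied_lines_def sensors_on_def mem_axis_line_iff)
  then have "card {i \<in> sensors N. t < p i $ j \<and> p i $ j \<le> t'} \<le> (\<Sum>L\<in>?O. card (?A L))"
    using card_UN_le[OF fin(1), of ?A] by simp
  then have "real (card {i \<in> sensors N. t < p i $ j \<and> p i $ j \<le> t'}) \<le> (\<Sum>L\<in>?O. real (card (?A L)))"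
    by (simp only: of_nat_sum[symmetric] of_nat_le_iff)
  also have "\<dots> \<le> (\<Sum>L\<in>?O. real N * (t' - t) + 1)"
    using fin(2) N t rows_and_columns_separated[OF rc]
    by (intro sum_mono card_separated_le) auto
  also have "\<dots> = real (card ?O) * (real N * (t' - t) + 1)" by simp
  also have "real (card ?O) = real N ^ (CARD('d) - 1)"
    using rc by (simp add: rows_and_columns_def)
  finally show ?thesis .
qed

text \<open>The regular grid is the competitor for the upper bound and shows that the constraints
  with \<open>s = v = 1 / N\<close> can be met.\<close>

lemma rows_and_columns_grid:
  fixes p :: "('d::finite \<Rightarrow> nat) \<Rightarrow> real^'d"
  assumes N: "1 \<le> N" and p: "p = (\<lambda>i. \<chi> j. real (i j) / real N)"
  shows "rows_and_columns N (1 / real N) (1 / real N) p"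
  unfolding rows_and_columns_def
proof (intro allI conjI ballI impI)
  have line_eq: "axis_line j (p i) = axis_line j (p i') \<longleftrightarrow> (\<forall>l. l \<noteq> j \<longrightarrow> i l = i' l)" for i i' j
    using N by (simp add: axis_line_eq_iff p)
  have upd: "i(j := k) \<in> sensors N" if "i \<in> sensors N" "k \<in> {1..N}" for i :: "'d \<Rightarrow> nat" and j k
    using that by (simp add: sensors_def)
  fix j :: 'd
  \<comment> \<open>Each line has exactly one representative whose \<open>j\<close>-th index is 1,
    so counting lines becomes counting a slice.\<close>
  have "(\<lambda>i. axis_line j (p i)) ` {i \<in> sensors N. i j = 1} = occupied_lines N p j"
  proof
    show "occupied_lines N p j \<subseteq> (\<lambda>i. axis_line j (p i)) ` {i \<in> sensors N. i j = 1}"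
      unfolding occupied_lines_def
    proof (rule image_subsetI)
      fix i :: "'d \<Rightarrow> nat" assume i: "i \<in> sensors N"
      have "axis_line j (p i) = axis_line j (p (i(j := 1)))" by (simp add: line_eq)
      then show "axis_line j (p i) \<in> (\<lambda>i. axis_line j (p i)) ` {i \<in> sensors N. i j = 1}"
        using upd[OF i, of 1 j] N by (intro image_eqI[of _ _ "i(j := 1)"]) auto
    qed
  qed (auto simp: occupied_lines_def)
  moreover have "inj_on (\<lambda>i. axis_line j (p i)) {i \<in> sensors N. i j = 1}"
  proof (rule inj_onI, rule ext)
    fix i i' l
    assume "i \<in> {i \<in> sensors N. i j = 1}" "i' \<in> {i \<in> sensors N. i j = 1}"
      "axis_line j (p i) = axis_line j (p i')"
    then show "i l = i' l" by (cases "l = j") (simp_all add: line_eq)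
  qed
  ultimately show "card (occupied_lines N p j) = N ^ (CARD('d) - 1)"
    using card_image[of "\<lambda>i. axis_line j (p i)" "{i \<in> sensors N. i j = 1}"]
      card_sensors_slice[of 1 N j] N by simp
  fix L assume "L \<in> occupied_lines N p j"
  then obtain i0 where i0: "i0 \<in> sensors N" "L = axis_line j (p i0)"
    by (auto simp: occupied_lines_def)
  have "sensors_on N p L = (\<lambda>k. i0(j := k)) ` {1..N}"
  proof (intro set_eqI iffI)
    fix i assume "i \<in> sensors_on N p L"
    then have "i \<in> sensors N" "\<And>l. l \<noteq> j \<Longrightarrow> i l = i0 l"
      using N by (auto simp: sensors_on_def i0 mem_axis_line_iff p)
    then show "i \<in> (\<lambda>k. i0(j := k)) ` {1..N}"
      by (intro image_eqI[of _ _ "i j"]) (auto simp: sensors_def)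
  qed (auto simp: sensors_on_def i0 mem_axis_line_iff p upd)
  note on = this
  show "card (sensors_on N p L) = N"
    unfolding on by (subst card_image) (auto intro!: inj_onI dest: fun_upd_eqD)
  fix i i' assume "consecutive p j (sensors_on N p L) i i'"
  then obtain k k' where k: "k \<in> {1..N}" "k' \<in> {1..N}" "i = i0(j := k)" "i' = i0(j := k')" "k \<noteq> k'"
    and le: "p i $ j \<le> p i' $ j"
    and none: "\<And>l. l \<in> {1..N} \<Longrightarrow> \<not> (p i $ j < p (i0(j := l)) $ j \<and> p (i0(j := l)) $ j < p i' $ j)"
    unfolding consecutive_def on by blast
  have "k < k'" using le k N by (simp add: p divide_le_cancel)
  \<comment> \<open>Otherwise the sensor with \<open>j\<close>-th index \<open>Suc k\<close> would
    lie strictly between the two.\<close>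
  moreover have "\<not> Suc k < k'" using none[of "Suc k"] k N by (auto simp: p divide_less_cancel)
  ultimately have k': "k' = Suc k" by simp
  have "dist (p i) (p i') = \<bar>p i $ j - p i' $ j\<bar>"
    by (rule dist_eq_coordinate) (simp add: p k)
  also have "\<dots> = 1 / real N" using N by (simp add: p k k' diff_divide_distrib[symmetric])
  finally show "1 / real N \<le> dist (p i) (p i')" "dist (p i) (p i') \<le> 1 / real N" by simp_all
qed

section \<open>Movement cost\<close>


text \<open>The thresholds separating \<open>x\<close> from \<open>y\<close> form the interval
  \<open>I\<close> of length \<open>\<bar>x - y\<bar>\<close>. For \<open>t\<close> in
  \<open>{0..1/4}\<close> the two thresholds run through the disjoint ranges \<open>{0..1/4}\<close>
  and \<open>{1/2..3/4}\<close>, so no part of \<open>I\<close> is counted twice.\<close>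

lemma lipschitz_thresholds:
  fixes x y :: real
  shows "(\<integral>\<^sup>+t. indicator {0..1/4} t *
      ennreal (of_bool ((x \<le> t) \<noteq> (y \<le> t)) + of_bool ((x \<le> t + 1/2) \<noteq> (y \<le> t + 1/2))) \<partial>lborel)
    \<le> ennreal \<bar>x - y\<bar>"
proof -
  define I where "I = {min x y..<max x y}"
  have I[measurable]: "I \<in> sets lborel" by (simp add: I_def)
  have ne: "of_bool ((x \<le> t) \<noteq> (y \<le> t)) = (indicator I t :: real)" for t
    by (auto simp: I_def min_def max_def indicator_def)
  have "(\<integral>\<^sup>+t. indicator {0..1/4} t *
      ennreal (of_bool ((x \<le> t) \<noteq> (y \<le> t)) + of_bool ((x \<le> t + 1/2) \<noteq> (y \<le> t + 1/2))) \<partial>lborel)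
    = (\<integral>\<^sup>+t. indicator {0..1/4} t * indicator I t + indicator {1/2..3/4} (1/2 + 1 * t) * indicator I (1/2 + 1 * t) \<partial>lborel)"
    unfolding ne by (intro nn_integral_cong) (auto simp: indicator_def add.commute)
  also have "\<dots> = (\<integral>\<^sup>+t. indicator {0..1/4} t * indicator I t \<partial>lborel)
      + (\<integral>\<^sup>+t. indicator {1/2..3/4} (1/2 + 1 * t) * indicator I (1/2 + 1 * t) \<partial>lborel)"
    by (rule nn_integral_add) measurable
  also have "(\<integral>\<^sup>+t. indicator {1/2..3/4} (1/2 + 1 * t) * indicator I (1/2 + 1 * t) \<partial>lborel)
      = (\<integral>\<^sup>+t. indicator {1/2..3/4} t * indicator I t \<partial>lborel)"
    using nn_integral_real_affine[of "\<lambda>t. indicator {1/2..3/4} t * indicator I t" 1 "1/2"] by simp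
  also have "(\<integral>\<^sup>+t. indicator {0..1/4} t * indicator I t \<partial>lborel) + \<dots>
      = (\<integral>\<^sup>+t. indicator {0..1/4} t * indicator I t + indicator {1/2..3/4} t * indicator I t \<partial>lborel)"
    by (rule nn_integral_add[symmetric]) measurable
  also have "\<dots> \<le> (\<integral>\<^sup>+t. indicator I t \<partial>lborel)"
    by (intro nn_integral_mono) (auto simp: indicator_def)
  also have "\<dots> = ennreal \<bar>x - y\<bar>"
    by (simp add: I_def min_def max_def)
  finally show ?thesis .
qed

text \<open>A window of length \<open>1/2\<close> of a row with gaps \<open>1/N\<close> contains at most \<open>N/2 + 1\<close> sensors.\<close>
definition window_excess :: "nat \<Rightarrow> (nat \<Rightarrow> real) \<Rightarrow> real \<Rightarrow> ennreal" where
  "window_excess N X t =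
     ennreal ((\<Sum>k=1..N. of_bool (t < X k \<and> X k \<le> t + 1/2)) - real N / 2 - 1)"

text \<open>A sum of \<open>of_bool\<close> terms, unlike a cardinality, is measurable term by term.
  Positions and threshold vary together, as exchanging the integrals requires.\<close>

lemma window_excess_measurable [measurable (raw)]:
  assumes [measurable]: "\<And>k. X k \<in> borel_measurable M" "f \<in> borel_measurable M"
  shows "(\<lambda>z. window_excess N (\<lambda>k. X k z) (f z)) \<in> borel_measurable M"
  unfolding window_excess_def by measurable

lemma real_card_Collect_eq_sum: "finite A \<Longrightarrow> real (card {x \<in> A. P x}) = (\<Sum>x\<in>A. of_bool (P x))"
  by (simp add: of_bool_def sum.If_cases Int_def)

lemma window_excess_eq:
  "window_excess N X t = ennreal (real (card {k \<in> {1..N}. t < X k \<and> X k \<le> t + 1/2}) - real N / 2 - 1)"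
  unfolding window_excess_def by (subst real_card_Collect_eq_sum) simp_all

text \<open>The final slab count is capped, so surplus sensors must leave the slab, each crossing
  the threshold \<open>t\<close> or \<open>t + 1/2\<close>. Integrating over \<open>t\<close> turns
  crossings into distances.\<close>

lemma window_excess_le_displacement:
  fixes p :: "('d::finite \<Rightarrow> nat) \<Rightarrow> real^'d" and X :: "nat \<Rightarrow> real"
  assumes rc: "rows_and_columns N (1 / real N) v p" and N: "1 \<le> N"
  shows "ennreal (real N ^ (CARD('d) - 1)) * (\<integral>\<^sup>+t. indicator {0..1/4} t * window_excess N X t \<partial>lborel)
    \<le> ennreal (\<Sum>i\<in>sensors N. \<bar>X (i j) - p i $ j\<bar>)"
proof -
  let ?b = "\<lambda>t i. of_bool ((X (i j) \<le> t) \<noteq> (p i $ j \<le> t)) :: real"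
  have pointwise: "ennreal (real N ^ (CARD('d) - 1)) * window_excess N X t
      \<le> (\<Sum>i\<in>sensors N. ennreal (?b t i + ?b (t + 1/2) i))" for t
  proof -
    let ?A = "{i \<in> sensors N. t < X (i j) \<and> X (i j) \<le> t + 1/2}"
    let ?B = "{i \<in> sensors N. t < p i $ j \<and> p i $ j \<le> t + 1/2}"
    have A: "real (card ?A) = real N ^ (CARD('d) - 1) * real (card {k \<in> {1..N}. t < X k \<and> X k \<le> t + 1/2})"
      using card_sensors_coordinate[of N "\<lambda>k. t < X k \<and> X k \<le> t + 1/2" j] by (simp only: of_nat_mult of_nat_power)
    have B: "real (card ?B) \<le> real N ^ (CARD('d) - 1) * (real N / 2 + 1)"
      using rows_and_columns_slab_card[OF rc N, of t "t + 1/2" j] by simp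
    have "real (card ?A) - real (card ?B) = (\<Sum>i\<in>sensors N.
        of_bool (t < X (i j) \<and> X (i j) \<le> t + 1/2) - of_bool (t < p i $ j \<and> p i $ j \<le> t + 1/2))"
      by (simp add: real_card_Collect_eq_sum sum_subtractf)
    also have "\<dots> \<le> (\<Sum>i\<in>sensors N. ?b t i + ?b (t + 1/2) i)"
      by (intro sum_mono) (auto simp: of_bool_def)
    finally have "real N ^ (CARD('d) - 1) * (real (card {k \<in> {1..N}. t < X k \<and> X k \<le> t + 1/2}) - real N / 2 - 1)
        \<le> (\<Sum>i\<in>sensors N. ?b t i + ?b (t + 1/2) i)"
      using A B by (simp add: algebra_simps)
    then have "ennreal (real N ^ (CARD('d) - 1) * (real (card {k \<in> {1..N}. t < X k \<and> X k \<le> t + 1/2}) - real N / 2 - 1))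
        \<le> ennreal (\<Sum>i\<in>sensors N. ?b t i + ?b (t + 1/2) i)"
      by (rule ennreal_leI)
    then show ?thesis
      unfolding window_excess_eq by (subst (asm) ennreal_mult', simp, subst (asm) sum_ennreal[symmetric]) auto
  qed
  have "ennreal (real N ^ (CARD('d) - 1)) * (\<integral>\<^sup>+t. indicator {0..1/4} t * window_excess N X t \<partial>lborel)
      = (\<integral>\<^sup>+t. indicator {0..1/4} t * (ennreal (real N ^ (CARD('d) - 1)) * window_excess N X t) \<partial>lborel)"
    by (subst nn_integral_cmult[symmetric]) (auto simp: mult_ac intro!: borel_measurable_times_ennreal window_excess_measurable)
  also have "\<dots> \<le> (\<integral>\<^sup>+t. indicator {0..1/4} t * (\<Sum>i\<in>sensors N. ennreal (?b t i + ?b (t + 1/2) i)) \<partial>lborel)"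
    by (intro nn_integral_mono mult_left_mono pointwise) simp
  also have "\<dots> = (\<Sum>i\<in>sensors N. \<integral>\<^sup>+t. indicator {0..1/4} t * ennreal (?b t i + ?b (t + 1/2) i) \<partial>lborel)"
    unfolding sum_distrib_left by (rule nn_integral_sum) measurable
  also have "\<dots> \<le> (\<Sum>i\<in>sensors N. ennreal \<bar>X (i j) - p i $ j\<bar>)"
    by (intro sum_mono lipschitz_thresholds)
  also have "\<dots> = ennreal (\<Sum>i\<in>sensors N. \<bar>X (i j) - p i $ j\<bar>)"
    by (intro sum_ennreal) simp
  finally show ?thesis .
qed

section \<open>From the 1-total to the a-total movement\<close>

lemma powr_ge_linear:
  fixes u a b :: real
  assumes "1 \<le> a" "0 < b" "0 \<le> u"
  shows "b powr (a - 1) * (u - b) \<le> u powr a"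
proof (cases "u \<le> b")
  case True
  then have "b powr (a - 1) * (u - b) \<le> 0" by (intro mult_nonneg_nonpos) auto
  then show ?thesis using powr_ge_zero[of u a] by linarith
next
  case False
  then have "b powr (a - 1) * (u - b) \<le> u powr (a - 1) * u"
    using assms by (intro mult_mono powr_mono2) auto
  also have "\<dots> = u powr a" using False assms by (simp add: powr_diff)
  finally show ?thesis .
qed

lemma card_sensors: "card (sensors N :: ('d::finite \<Rightarrow> nat) set) = N ^ CARD('d)"
proof -
  fix j :: 'd
  have "card {i \<in> (sensors N :: ('d \<Rightarrow> nat) set). True} = N ^ (CARD('d) - 1) * card {k \<in> {1..N}. True}"
    by (rule card_sensors_coordinate[where j = j])
  moreover have "{k \<in> {1..N}. True} = {1..N}" by auto
  ultimately show ?thesis by (simp add: power_eq_if[of N "CARD('d)"] mult.commute del: atLeastAtMost_iff)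
qed

lemma total_movement_nonneg: "0 \<le> total_movement a N m"
  by (simp add: total_movement_def sum_nonneg)

text \<open>Sum the linear minorant over all sensors, keeping only the displacement along
  \<open>j\<close>. The constant term, once per sensor, is moved to the right.\<close>

lemma total_movement_ge_linear:
  fixes m :: "('d::finite \<Rightarrow> nat) \<Rightarrow> real^'d"
  assumes "1 \<le> a" "0 < b"
  shows "b powr (a - 1) * (\<Sum>i\<in>sensors N. \<bar>m i $ j\<bar>) \<le> total_movement a N m + b powr a * real N ^ CARD('d)"
proof -
  have "(\<Sum>i\<in>sensors N. b powr (a - 1) * (\<bar>m i $ j\<bar> - b)) \<le> total_movement a N m"
    unfolding total_movement_def
  proof (intro sum_mono)
    fix i :: "'d \<Rightarrow> nat"
    have "b powr (a - 1) * (\<bar>m i $ j\<bar> - b) \<le> \<bar>m i $ j\<bar> powr a"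
      using assms by (intro powr_ge_linear) auto
    also have "\<dots> \<le> (\<Sum>j\<in>UNIV. \<bar>m i $ j\<bar> powr a)"
      by (intro member_le_sum) auto
    finally show "b powr (a - 1) * (\<bar>m i $ j\<bar> - b) \<le> (\<Sum>j\<in>UNIV. \<bar>m i $ j\<bar> powr a)" .
  qed
  moreover have "b powr (a - 1) * b = b powr a" using assms by (simp add: powr_diff)
  ultimately show ?thesis
    by (simp add: right_diff_distrib sum_subtractf sum_distrib_left card_sensors mult.commute)
qed

section \<open>The minimal movement as an infimum\<close>

lemma reallocation_exists:
  fixes x :: "('d::finite \<Rightarrow> nat) \<Rightarrow> real^'d"
  assumes "1 \<le> N"
  shows "reallocation N (1 / real N) (1 / real N) x (\<lambda>i. (\<chi> j. real (i j) / real N) - x i)"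
  unfolding reallocation_def using rows_and_columns_grid[OF assms refl] by simp

lemma minimal_movement_le:
  assumes "reallocation N s v x m"
  shows "minimal_movement a N s v x \<le> total_movement a N m"
  unfolding minimal_movement_def using assms
  by (intro cInf_lower) (auto intro!: bdd_belowI[of _ 0] total_movement_nonneg)

lemma minimal_movement_greatest:
  fixes x :: "('d::finite \<Rightarrow> nat) \<Rightarrow> real^'d"
  assumes "1 \<le> N" and "\<And>m. reallocation N (1 / real N) (1 / real N) x m \<Longrightarrow> r \<le> total_movement a N m"
  shows "r \<le> minimal_movement a N (1 / real N) (1 / real N) x"
  \<comment> \<open>The grid reallocation makes the set under the infimum nonempty.\<close>
  unfolding minimal_movement_def using assms reallocation_exists[of N x]
  by (intro cInf_greatest) auto

lemma minimal_movement_nonneg: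
  fixes x :: "('d::finite \<Rightarrow> nat) \<Rightarrow> real^'d"
  assumes "1 \<le> N"
  shows "0 \<le> minimal_movement a N (1 / real N) (1 / real N) x"
  using assms by (intro minimal_movement_greatest total_movement_nonneg)

lemma minimal_movement_ge:
  fixes X :: "'d::finite \<Rightarrow> nat \<Rightarrow> real"
  assumes N: "1 \<le> N" and a: "1 \<le> a" and b: "0 < b"
  shows "ennreal (b powr (a - 1)) * (ennreal (real N ^ (CARD('d) - 1)) *
      (\<integral>\<^sup>+t. indicator {0..1/4} t * window_excess N (X j) t \<partial>lborel))
    \<le> ennreal (minimal_movement a N (1 / real N) (1 / real N) (\<lambda>i. \<chi> j. X j (i j)) + b powr a * real N ^ CARD('d))"
    (is "?D \<le> ennreal (minimal_movement a N _ _ ?x + ?c)")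
proof -
  have D: "?D \<le> ennreal (total_movement a N m + ?c)" if m: "reallocation N (1 / real N) (1 / real N) ?x m" for m
  proof -
    have rc: "rows_and_columns N (1 / real N) (1 / real N) (\<lambda>i. ?x i + m i)"
      using m by (simp add: reallocation_def)
    have "?D \<le> ennreal (b powr (a - 1)) * ennreal (\<Sum>i\<in>sensors N. \<bar>X j (i j) - (?x i + m i) $ j\<bar>)"
      by (intro mult_left_mono window_excess_le_displacement[OF rc N]) simp
    also have "\<dots> = ennreal (b powr (a - 1) * (\<Sum>i\<in>sensors N. \<bar>m i $ j\<bar>))"
      by (simp add: ennreal_mult')
    also have "\<dots> \<le> ennreal (total_movement a N m + ?c)"
      by (intro ennreal_leI total_movement_ge_linear a b)
    finally show ?thesis .
  qed
  \<comment> \<open>A single reallocation bounds \<open>?D\<close>, which can then be replaced by a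
    real number and compared with the real infimum.\<close>
  from D[OF reallocation_exists[OF N]] have "?D < \<top>"
    by (rule le_less_trans) simp
  then obtain r where r: "?D = ennreal r" "0 \<le> r"
    by (cases ?D) auto
  have "r - ?c \<le> minimal_movement a N (1 / real N) (1 / real N) ?x"
  proof (rule minimal_movement_greatest[OF N])
    fix m assume "reallocation N (1 / real N) (1 / real N) ?x m"
    then have "ennreal r \<le> ennreal (total_movement a N m + ?c)" using D r by simp
    then have "r \<le> total_movement a N m + ?c"
      using total_movement_nonneg[of a N m] by (subst (asm) ennreal_le_iff) auto
    then show "r - ?c \<le> total_movement a N m" by simp
  qed
  then show ?thesis unfolding r by (intro ennreal_leI) simp
qed

lemma minimal_movement_le_grid:
  fixes X :: "'d::finite \<Rightarrow> nat \<Rightarrow> real"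
  assumes N: "1 \<le> N"
  shows "minimal_movement a N (1 / real N) (1 / real N) (\<lambda>i. \<chi> j. X j (i j))
    \<le> real N ^ (CARD('d) - 1) * (\<Sum>j\<in>UNIV. \<Sum>k=1..N. \<bar>X j k - real k / real N\<bar> powr a)"
proof -
  let ?m = "\<lambda>i. (\<chi> j. real (i j) / real N) - (\<chi> j. X j (i j)) :: real^'d"
  have "minimal_movement a N (1 / real N) (1 / real N) (\<lambda>i. \<chi> j. X j (i j)) \<le> total_movement a N ?m"
    by (intro minimal_movement_le reallocation_exists N)
  also have "\<dots> = (\<Sum>j\<in>UNIV. \<Sum>i\<in>sensors N. \<bar>X j (i j) - real (i j) / real N\<bar> powr a)"
    unfolding total_movement_def by (subst sum.swap) (simp add: abs_minus_commute)
  also have "\<dots> = (\<Sum>j\<in>UNIV. real N ^ (CARD('d) - 1) * (\<Sum>k=1..N. \<bar>X j k - real k / real N\<bar> powr a))"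
    by (intro sum.cong refl sum_sensors_coordinate)
  finally show ?thesis by (simp only: sum_distrib_left)
qed

text \<open>The set of final configurations does not depend on the initial positions, so the cost is an infimum
  of continuous functions of them and hence upper semicontinuous.\<close>
lemma minimal_movement_measurable:
  fixes X :: "'d::finite \<Rightarrow> nat \<Rightarrow> 'w \<Rightarrow> real"
  assumes N: "1 \<le> N" and a: "0 < a" and X: "\<And>j k. X j k \<in> borel_measurable M"
  shows "(\<lambda>\<omega>. minimal_movement a N (1 / real N) (1 / real N) (\<lambda>i. \<chi> j. X j (i j) \<omega>)) \<in> borel_measurable M"
proof -
  let ?x = "\<lambda>(Z :: 'd \<Rightarrow> nat \<Rightarrow> real) i. \<chi> j. Z j (i j)"
  let ?V = "{p :: ('d \<Rightarrow> nat) \<Rightarrow> real^'d. rows_and_columns N (1 / real N) (1 / real N) p}"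
  define f where "f Z = minimal_movement a N (1 / real N) (1 / real N) (?x Z)" for Z
  have sublevel: "{Z. f Z < r} = (\<Union>p\<in>?V. {Z. total_movement a N (\<lambda>i. p i - ?x Z i) < r})" for r
  proof (intro set_eqI iffI)
    fix Z assume "Z \<in> {Z. f Z < r}"
    then obtain m where m: "reallocation N (1 / real N) (1 / real N) (?x Z) m" "total_movement a N m < r"
      using minimal_movement_greatest[OF N, of "?x Z" r a] unfolding f_def by (force simp: not_less[symmetric])
    then have "(\<lambda>i. ?x Z i + m i) \<in> ?V" by (simp add: reallocation_def)
    then show "Z \<in> (\<Union>p\<in>?V. {Z. total_movement a N (\<lambda>i. p i - ?x Z i) < r})"
      by (rule UN_I) (simp add: m)
  next
    fix Z assume "Z \<in> (\<Union>p\<in>?V. {Z. total_movement a N (\<lambda>i. p i - ?x Z i) < r})"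
    then obtain p where p: "p \<in> ?V" "total_movement a N (\<lambda>i. p i - ?x Z i) < r" by blast
    then have "reallocation N (1 / real N) (1 / real N) (?x Z) (\<lambda>i. p i - ?x Z i)"
      by (simp add: reallocation_def)
    from minimal_movement_le[OF this, of a] p(2) show "Z \<in> {Z. f Z < r}" by (simp add: f_def)
  qed
  have coord: "continuous_on UNIV (\<lambda>Z :: 'd \<Rightarrow> nat \<Rightarrow> real. Z j k)" for j k
    using continuous_on_compose2[OF continuous_on_product_coordinates[of k] continuous_on_product_coordinates[of j]]
    by simp
  have "open {Z. total_movement a N (\<lambda>i. p i - ?x Z i) < r}" for p r
    unfolding total_movement_def using a
    by (intro open_Collect_less continuous_on_sum continuous_on_powr' continuous_intros coord) (auto intro!: continuous_intros coord)
  \<comment> \<open>The union runs over uncountably many final configurations; openness survives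
    this, while measurability alone would not.\<close>
  then have "open {Z. f Z < r}" for r
    unfolding sublevel by blast
  then have "f \<in> borel_measurable borel"
    by (simp add: borel_measurable_iff_less)
  moreover have "(\<lambda>\<omega> j k. X j k \<omega>) \<in> borel_measurable M"
    by (intro measurable_coordinatewise_then_product X)
  ultimately show ?thesis
    unfolding f_def by (rule measurable_compose_rev)
qed

section \<open>Expected cost\<close>


text \<open>With \<open>n = N ^ d\<close> the claimed order is \<open>N powr (d - a / 2)\<close>:
  one factor \<open>N powr (- a / 2)\<close> per sensor.\<close>

lemma grid_scale_powr:
  assumes "1 \<le> N" "1 \<le> d"
  shows "real (N ^ d) powr (1 - a / (2 * real d)) = real N ^ d * real N powr (- a / 2)"
proof -
  have "real (N ^ d) powr (1 - a / (2 * real d)) = real N powr (real d * (1 - a / (2 * real d)))"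
    using assms by (simp add: powr_realpow[symmetric] powr_powr)
  also have "real d * (1 - a / (2 * real d)) = real d + - a / 2"
    using assms by (simp add: field_simps)
  also have "real N powr (real d + - a / 2) = real N ^ d * real N powr (- a / 2)"
    using assms by (subst powr_add) (simp add: powr_realpow)
  finally show ?thesis .
qed

text \<open>The cost is dominated by that of moving to the grid, whose mean is a sum of arrival time
  deviations. The same finite bound on the nonnegative integral yields integrability.\<close>

lemma
  fixes C :: "'d::finite \<Rightarrow> real \<Rightarrow> 'w \<Rightarrow> nat" and M :: "'w measure"
  assumes N: "1 \<le> N" and a: "0 < a"
    and P: "\<And>j. poisson_process M (real N) (C j)"
  defines "cost \<equiv> \<lambda>\<omega>. minimal_movement a N (1 / real N) (1 / real N) (initial_position C \<omega>)"
  shows cost_integrable: "integrable M cost"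
    and cost_expectation_le: "prob_space.expectation M cost
      \<le> real CARD('d) * (2 * exp (1/2) * (2 * a) powr a) * (real N ^ CARD('d) * real N powr (- a / 2))"
proof -
  interpret P: poisson_process M "real N" "C j" for j by (rule P)
  let ?X = "\<lambda>j k \<omega>. arrival_time (C j) k \<omega>"
  let ?K = "2 * exp (1/2) * (2 * a) powr a * real N powr (- a / 2)"
  let ?U = "real CARD('d) * (2 * exp (1/2) * (2 * a) powr a) * (real N ^ CARD('d) * real N powr (- a / 2))"
  have cost: "cost = (\<lambda>\<omega>. minimal_movement a N (1 / real N) (1 / real N) (\<lambda>i. \<chi> j. ?X j (i j) \<omega>))"
    by (simp add: cost_def initial_position_def[abs_def])
  have [measurable]: "cost \<in> borel_measurable M"
    unfolding cost by (intro minimal_movement_measurable N a P.arrival_time_measurable)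
  have nonneg: "0 \<le> cost \<omega>" for \<omega>
    unfolding cost by (rule minimal_movement_nonneg[OF N])
  have "(\<integral>\<^sup>+\<omega>. ennreal (cost \<omega>) \<partial>M)
      \<le> (\<integral>\<^sup>+\<omega>. ennreal (real N ^ (CARD('d) - 1)) *
          (\<Sum>j\<in>UNIV. \<Sum>k=1..N. ennreal (\<bar>?X j k \<omega> - real k / real N\<bar> powr a)) \<partial>M)"
  proof (intro nn_integral_mono)
    fix \<omega>
    have "ennreal (cost \<omega>) \<le> ennreal (real N ^ (CARD('d) - 1) *
        (\<Sum>j\<in>UNIV. \<Sum>k=1..N. \<bar>?X j k \<omega> - real k / real N\<bar> powr a))"
      unfolding cost by (intro ennreal_leI minimal_movement_le_grid N)
    then show "ennreal (cost \<omega>) \<le> ennreal (real N ^ (CARD('d) - 1)) *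
        (\<Sum>j\<in>UNIV. \<Sum>k=1..N. ennreal (\<bar>?X j k \<omega> - real k / real N\<bar> powr a))"
      by (simp add: ennreal_mult' sum_nonneg)
  qed
  also have "\<dots> = ennreal (real N ^ (CARD('d) - 1)) *
      (\<Sum>j\<in>UNIV. \<Sum>k=1..N. \<integral>\<^sup>+\<omega>. ennreal (\<bar>?X j k \<omega> - real k / real N\<bar> powr a) \<partial>M)"
    by (simp add: nn_integral_cmult nn_integral_sum del: sum_ennreal)
  also have "\<dots> \<le> ennreal (real N ^ (CARD('d) - 1)) * (\<Sum>j\<in>(UNIV::'d set). \<Sum>k=1..N. ennreal ?K)"
    using N a by (intro mult_left_mono sum_mono P.arrival_time_deviation) auto
  also have "\<dots> = ennreal (real N ^ (CARD('d) - 1) * (\<Sum>j\<in>(UNIV::'d set). \<Sum>k=1..N. ?K))"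
    by (simp add: ennreal_mult' ennreal_of_nat_eq_real_of_nat)
  also have "real N ^ (CARD('d) - 1) * (\<Sum>j\<in>(UNIV::'d set). \<Sum>k=1..N. ?K) = ?U"
    by (simp add: power_eq_if[of _ "CARD('d)"])
  finally have le: "(\<integral>\<^sup>+\<omega>. ennreal (cost \<omega>) \<partial>M) \<le> ennreal ?U" .
  then have int: "integrable M cost"
    using nonneg by (intro integrableI_nonneg) (auto simp: less_top[symmetric] top_unique)
  then show "integrable M cost" .
  have "ennreal (P.expectation cost) \<le> ennreal ?U"
    using le nonneg by (subst nn_integral_eq_integral[symmetric, OF int]) auto
  then show "P.expectation cost \<le> ?U"
    by (subst (asm) ennreal_le_iff) auto
qed

lemma cost_expectation_ge:
  fixes C :: "'d::finite \<Rightarrow> real \<Rightarrow> 'w \<Rightarrow> nat" and M :: "'w measure"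
  assumes N: "3136 \<le> N" and a: "1 \<le> a"
    and P: "\<And>j. poisson_process M (real N) (C j)"
  defines "cost \<equiv> \<lambda>\<omega>. minimal_movement a N (1 / real N) (1 / real N) (initial_position C \<omega>)"
  shows "(1/256) powr a * (real N ^ CARD('d) * real N powr (- a / 2)) \<le> prob_space.expectation M cost"
proof -
  interpret P: poisson_process M "real N" "C j" for j by (rule P)
  \<comment> \<open>Chosen so that \<open>2 * b * N = sqrt N / 128\<close>: the displacement bound
    is then at least \<open>2 * c\<close>, and losing \<open>c\<close> to the linear minorant leaves
    \<open>c\<close>.\<close>
  define b where "b = 1 / (256 * sqrt (real N))"
  define c where "c = b powr a * real N ^ CARD('d)"
  fix j :: 'd
  let ?X = "\<lambda>k \<omega>. arrival_time (C j) k \<omega>"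
  have N1: "1 \<le> N" and b: "0 < b" using N by (auto simp: b_def)
  \<comment> \<open>Here \<open>3136 = 56^2\<close>, and from 56 on \<open>sqrt N / 16 - 7/4\<close>
    is at least \<open>sqrt N / 32\<close>; a quarter of this, the length of the range of
    \<open>t\<close>, is \<open>sqrt N / 128\<close>.\<close>
  have sqrt_N: "56 \<le> sqrt (real N)" using N by (intro real_le_rsqrt) simp
  have int: "integrable M cost"
    unfolding cost_def using a by (intro cost_integrable N1 P) simp
  have nonneg: "0 \<le> cost \<omega>" for \<omega>
    unfolding cost_def by (rule minimal_movement_nonneg[OF N1])
  have c: "0 \<le> c" by (simp add: c_def)
  have slice: "ennreal (sqrt (real N) / 16 - 7/4) * indicator {0..1/4} t
      \<le> (\<integral>\<^sup>+\<omega>. indicator {0..1/4} t * window_excess N (\<lambda>k. ?X k \<omega>) t \<partial>M)" for t :: real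
    using P.expected_excess[of N t j] N by (auto simp: window_excess_eq indicator_def)
  have "ennreal (b powr (a - 1)) * (ennreal (real N ^ (CARD('d) - 1)) *
      (ennreal (sqrt (real N) / 16 - 7/4) * ennreal (1/4)))
    = ennreal (b powr (a - 1)) * (ennreal (real N ^ (CARD('d) - 1)) *
      (\<integral>\<^sup>+t. ennreal (sqrt (real N) / 16 - 7/4) * indicator {0..1/4::real} t \<partial>lborel))"
    by (simp add: nn_integral_cmult_indicator)
  also have "\<dots> \<le> ennreal (b powr (a - 1)) * (ennreal (real N ^ (CARD('d) - 1)) *
      (\<integral>\<^sup>+t. \<integral>\<^sup>+\<omega>. indicator {0..1/4} t * window_excess N (\<lambda>k. ?X k \<omega>) t \<partial>M \<partial>lborel))"
    by (intro mult_left_mono nn_integral_mono slice) auto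
  \<comment> \<open>Tonelli: the probabilistic estimate is for fixed \<open>t\<close>, the geometric
    one for a fixed outcome.\<close>
  also have "(\<integral>\<^sup>+t. \<integral>\<^sup>+\<omega>. indicator {0..1/4} t * window_excess N (\<lambda>k. ?X k \<omega>) t \<partial>M \<partial>lborel)
      = (\<integral>\<^sup>+\<omega>. \<integral>\<^sup>+t. indicator {0..1/4} t * window_excess N (\<lambda>k. ?X k \<omega>) t \<partial>lborel \<partial>M)"
  proof -
    interpret pair_sigma_finite M "lborel :: real measure"
      by (intro pair_sigma_finite.intro sigma_finite_lborel) unfold_locales
    show ?thesis
      using Fubini'[of "\<lambda>\<omega> t. indicator {0..1/4} t * window_excess N (\<lambda>k. ?X k \<omega>) t"] by measurable
  qed
  also have "ennreal (b powr (a - 1)) * (ennreal (real N ^ (CARD('d) - 1)) * \<dots>)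
      = (\<integral>\<^sup>+\<omega>. ennreal (b powr (a - 1)) * (ennreal (real N ^ (CARD('d) - 1)) *
          (\<integral>\<^sup>+t. indicator {0..1/4} t * window_excess N (\<lambda>k. ?X k \<omega>) t \<partial>lborel)) \<partial>M)"
    by (simp add: nn_integral_cmult)
  also have "\<dots> \<le> (\<integral>\<^sup>+\<omega>. ennreal (cost \<omega> + c) \<partial>M)"
    unfolding cost_def c_def initial_position_def[abs_def]
    by (intro nn_integral_mono minimal_movement_ge N1 a b)
  also have "\<dots> = ennreal (\<integral>\<omega>. cost \<omega> + c \<partial>M)"
    using nonneg c int by (intro nn_integral_eq_integral) auto
  also have "(\<integral>\<omega>. cost \<omega> + c \<partial>M) = P.expectation cost + c"
    using int by (simp add: P.prob_space)
  finally have le: "ennreal (b powr (a - 1)) * (ennreal (real N ^ (CARD('d) - 1)) *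
      (ennreal (sqrt (real N) / 16 - 7/4) * ennreal (1/4))) \<le> ennreal (P.expectation cost + c)" .
  have "ennreal (b powr (a - 1) * (real N ^ (CARD('d) - 1) * ((sqrt (real N) / 16 - 7/4) * (1/4))))
      \<le> ennreal (P.expectation cost + c)"
  proof -
    have "0 \<le> b powr (a - 1)" "0 \<le> real N ^ (CARD('d) - 1)" "0 \<le> sqrt (real N) / 16 - 7/4"
      using sqrt_N by simp_all
    then show ?thesis using le by (simp only: ennreal_mult')
  qed
  then have "b powr (a - 1) * (real N ^ (CARD('d) - 1) * ((sqrt (real N) / 16 - 7/4) * (1/4))) \<le> P.expectation cost + c"
    using nonneg c by (subst (asm) ennreal_le_iff) (auto intro!: add_nonneg_nonneg)
  moreover have "2 * c \<le> b powr (a - 1) * (real N ^ (CARD('d) - 1) * ((sqrt (real N) / 16 - 7/4) * (1/4)))"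
  proof -
    have bN: "sqrt (real N) / 128 = 2 * (b * real N)" using N by (simp add: b_def real_div_sqrt)
    have "2 * c = b powr (a - 1) * (real N ^ (CARD('d) - 1) * (sqrt (real N) / 128))"
      unfolding bN using b by (simp add: c_def power_eq_if[of _ "CARD('d)"] powr_diff)
    also have "\<dots> \<le> b powr (a - 1) * (real N ^ (CARD('d) - 1) * ((sqrt (real N) / 16 - 7/4) * (1/4)))"
      using sqrt_N by (intro mult_left_mono) auto
    finally show ?thesis .
  qed
  moreover have "c = (1/256) powr a * (real N ^ CARD('d) * real N powr (- a / 2))"
  proof -
    have "b powr a = (1/256) powr a * real N powr (- a / 2)"
      using N by (simp add: b_def powr_divide powr_mult powr_half_sqrt[symmetric] powr_powr powr_minus_divide)
    then show ?thesis by (simp add: c_def)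
  qed
  ultimately show ?thesis by linarith
qed

theorem theorem10:
  fixes a :: real
    and M :: "nat \<Rightarrow> 'w measure"
    and C :: "nat \<Rightarrow> 'd::finite \<Rightarrow> real \<Rightarrow> 'w \<Rightarrow> nat"
    and cost :: "nat \<Rightarrow> 'w \<Rightarrow> real"
  assumes "2 \<le> CARD('d)" and "0 < a"
    and "\<And>N j. 1 \<le> N \<Longrightarrow> poisson_process (M N) (real N) (C N j)"
    and "\<And>N. 1 \<le> N \<Longrightarrow> independent_processes (M N) (C N)"
  defines "cost \<equiv> \<lambda>N \<omega>. minimal_movement a N (1 / real N) (1 / real N) (initial_position (C N) \<omega>)"
  shows "(\<forall>N\<ge>1. integrable (M N) (cost N)) \<and>
    (1 \<le> a \<longrightarrow>
      (\<lambda>N. prob_space.expectation (M N) (cost N))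
        \<in> \<Theta>(\<lambda>N. real (N ^ CARD('d)) powr (1 - a / (2 * real CARD('d))))) \<and>
    (a < 1 \<longrightarrow>
      (\<lambda>N. prob_space.expectation (M N) (cost N))
        \<in> O(\<lambda>N. real (N ^ CARD('d)) powr (1 - a / (2 * real CARD('d)))))"
proof -
  let ?e = "\<lambda>N. prob_space.expectation (M N) (cost N)"
  let ?r = "\<lambda>N. real (N ^ CARD('d)) powr (1 - a / (2 * real CARD('d)))"
  have int: "integrable (M N) (cost N)" if "1 \<le> N" for N
    unfolding cost_def using that assms(2,3) by (intro cost_integrable)
  have r: "?r N = real N ^ CARD('d) * real N powr (- a / 2)" if "1 \<le> N" for N
    using that by (intro grid_scale_powr) (simp_all add: Suc_leI)
  have e_nonneg: "0 \<le> ?e N" if "1 \<le> N" for N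
    unfolding cost_def by (intro integral_nonneg_AE AE_I2 minimal_movement_nonneg that)
  have upper: "?e \<in> O(?r)"
  proof (rule bigoI)
    show "\<forall>\<^sub>F N in sequentially. norm (?e N) \<le> real CARD('d) * (2 * exp (1/2) * (2 * a) powr a) * norm (?r N)"
    proof (rule eventually_sequentiallyI[of 1])
      fix N :: nat assume N: "1 \<le> N"
      have "?e N \<le> real CARD('d) * (2 * exp (1/2) * (2 * a) powr a) * ?r N"
        unfolding r[OF N] unfolding cost_def using N assms(2,3) by (intro cost_expectation_le)
      then show "norm (?e N) \<le> real CARD('d) * (2 * exp (1/2) * (2 * a) powr a) * norm (?r N)"
        using e_nonneg[OF N] by simp
    qed
  qed
  have lower: "?e \<in> \<Omega>(?r)" if a: "1 \<le> a"
  proof (rule landau_omega.bigI[of "(1/256) powr a"])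
    show "\<forall>\<^sub>F N in sequentially. norm (?e N) \<ge> (1/256) powr a * norm (?r N)"
    proof (rule eventually_sequentiallyI[of 3136])
      fix N :: nat assume N: "3136 \<le> N"
      then have N1: "1 \<le> N" by simp
      have "(1/256) powr a * ?r N \<le> ?e N"
        unfolding r[OF N1] unfolding cost_def using N N1 a assms(3) by (intro cost_expectation_ge)
      then show "norm (?e N) \<ge> (1/256) powr a * norm (?r N)"
        using e_nonneg[OF N1] by simp
    qed
  qed simp
  show ?thesis
    using int upper lower by (auto intro: bigthetaI)
qed

end
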